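(* Let $X$ be a finite simplicial complex with shape $x$ and let $m\ge1$ be an integer. Then the $m$-density $b_m(x)$ is a threshold for the appearance of $X$ in $\Gamma_m$; that is, if $K\sim\Gamma_{n,m,p}$ with $p=n^{-1/b}$ for a constant $b>0$, then as $n\to\infty$: if $b>b_m(x)$, $K$ contains a copy of $X$ with probability tending to $1$, and if $b<b_m(x)$, $K$ contains a copy of $X$ with probability tending to $0$.
   Context: For a graph $G$ and a vertex set $f$, a common neighbor of $f$ is a vertex $v\notin f$ adjacent to all vertices of $f$; $N_m(G)$ is the simplicial complex of vertex sets with at least $m$ common neighbors. $\Gamma_{n,m,p}$ is the distribution of $N_m(G)$ for $G$ the Erdős–Rényi random graph $G(n,p)$ on $[n]$. A complex $K$ contains a copy of $X$ if there is an injective map from the vertices of $X$ to those of $K$ sending faces to faces. Let $F$ be a finite set. An $F$-set is a map $W:F\to\mathcal P(S)$, $S$ finite, with $W_0=\bigcup_{f\in F}W(f)$. For $A\subseteq F$: $W^\cap_A=\bigcap_{f\in A}W(f)$ (with $W^\cap_\emptyset=W_0$), $W^\cup_A=\bigcup_{f\in A}W(f)$, and $W^!_A=\{v\in W_0:\{f\in F: v\in W(f)\}=A\}$. Its shape $w$ is given by $w^*_A=|W^*_A|$ for $*\in\{\cap,!,\cup\}$, and $w_0=|W_0|$; an $F$-shape means the shape of some $F$-set. For $F$-shapes, $z\le x$ means $z^!_A\le x^!_A$ for all $A\subseteq F$; $w$ is $m$-pure if $w^\cap_{\{f\}}=m$ for all $f\in F$. For $F$-shapes $x,w$ set $(xw)_0=\sum_{\emptyset\ne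 B\subseteq F}(-1)^{|B|-1}x^\cap_Bw^\cap_B$ and $b(x,w)=\frac{(xw)_0}{x_0+w_0}$. The shape of a simplicial complex $X$ is the shape of the $F$-set $f\mapsto f$, where $F$ is the set of facets of $X$. The $m$-density of $x$ is $b_m(x)=\min_{w\ m\text{-pure}}\ \max\{\,b(z,v): z,v\ F\text{-shapes},\ z_0>0,\ v_0>0,\ z\le x,\ v\le w\,\}$. *)

theory Defs
  imports "HOL-Probability.Probability"
begin

section \<open>Finite simplicial complexes\<close>

text \<open>The empty set counts as a face, and the void complex (no faces at all) is allowed.\<close>

definition abstract_simplicial_complex :: "'a set set \<Rightarrow> bool" where
  "abstract_simplicial_complex X \<longleftrightarrow> (\<forall>f\<in>X. finite f \<and> (\<forall>g. g \<subseteq> f \<longrightarrow> g \<in> X))"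

definition vertices :: "'a set set \<Rightarrow> 'a set" where
  "vertices X = \<Union>X"

definition facets :: "'a set set \<Rightarrow> 'a set set" where
  "facets X = {f \<in> X. \<forall>g\<in>X. f \<subseteq> g \<longrightarrow> g = f}"

definition contains_copy :: "'b set set \<Rightarrow> 'a set set \<Rightarrow> bool" where
  "contains_copy K X \<longleftrightarrow>
     (\<exists>\<phi>. inj_on \<phi> (vertices X) \<and> \<phi> ` vertices X \<subseteq> vertices K \<and> (\<forall>f\<in>X. \<phi> ` f \<in> K))"

section \<open>Random neighborhood complexes\<close>

text \<open>A simple graph is given by a vertex set \<open>V\<close> and a set \<open>E\<close> of two-element subsets of \<open>V\<close>.\<close>

definition common_neighbors :: "'v set \<Rightarrow> 'v set set \<Rightarrow> 'v set \<Rightarrow> 'v set" where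
  "common_neighbors V E f = {v \<in> V. v \<notin> f \<and> (\<forall>u\<in>f. {u, v} \<in> E)}"

definition neighborhood_complex :: "nat \<Rightarrow> 'v set \<Rightarrow> 'v set set \<Rightarrow> 'v set set" where
  "neighborhood_complex m V E = {f. f \<subseteq> V \<and> m \<le> card (common_neighbors V E f)}"

definition possible_edges :: "nat \<Rightarrow> nat set set" where
  "possible_edges n = {e. e \<subseteq> {1..n} \<and> card e = 2}"

definition erdos_renyi :: "nat \<Rightarrow> real \<Rightarrow> nat set set pmf" where
  "erdos_renyi n p =
     map_pmf (\<lambda>\<omega>. {e \<in> possible_edges n. \<omega> e})
       (Pi_pmf (possible_edges n) False (\<lambda>_. bernoulli_pmf p))"

definition Gamma_complex :: "nat \<Rightarrow> nat \<Rightarrow> real \<Rightarrow> nat set set pmf" where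
  "Gamma_complex n m p = map_pmf (neighborhood_complex m {1..n}) (erdos_renyi n p)"

section \<open>\<open>F\<close>-sets and their shapes\<close>

definition is_Fset :: "'f set \<Rightarrow> ('f \<Rightarrow> 's set) \<Rightarrow> bool" where
  "is_Fset F W \<longleftrightarrow> (\<exists>S. finite S \<and> (\<forall>f\<in>F. W f \<subseteq> S))"

definition Fset_total :: "'f set \<Rightarrow> ('f \<Rightarrow> 's set) \<Rightarrow> 's set" where
  "Fset_total F W = (\<Union>f\<in>F. W f)"

definition Fset_inter :: "'f set \<Rightarrow> ('f \<Rightarrow> 's set) \<Rightarrow> 'f set \<Rightarrow> 's set" where
  "Fset_inter F W A = (if A = {} then Fset_total F W else (\<Inter>f\<in>A. W f))"

definition Fset_union :: "('f \<Rightarrow> 's set) \<Rightarrow> 'f set \<Rightarrow> 's set" where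
  "Fset_union W A = (\<Union>f\<in>A. W f)"

definition Fset_exact :: "'f set \<Rightarrow> ('f \<Rightarrow> 's set) \<Rightarrow> 'f set \<Rightarrow> 's set" where
  "Fset_exact F W A = {v \<in> Fset_total F W. {f \<in> F. v \<in> W f} = A}"

record 'f shape =
  sh_inter :: "'f set \<Rightarrow> nat"
  sh_exact :: "'f set \<Rightarrow> nat"
  sh_union :: "'f set \<Rightarrow> nat"
  sh_total :: nat

text \<open>The three families are indexed by the subsets of \<open>F\<close>, so they are restricted to
  \<open>Pow F\<close>; two shapes are then equal iff they agree on all \<open>A \<subseteq> F\<close>.\<close>

definition shape_of :: "'f set \<Rightarrow> ('f \<Rightarrow> 's set) \<Rightarrow> 'f shape" where
  "shape_of F W =
     \<lparr> sh_inter = (\<lambda>A\<in>Pow F. card (Fset_inter F W A)),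
       sh_exact = (\<lambda>A\<in>Pow F. card (Fset_exact F W A)),
       sh_union = (\<lambda>A\<in>Pow F. card (Fset_union W A)),
       sh_total = card (Fset_total F W) \<rparr>"

text \<open>The ground set \<open>S\<close> of an \<open>F\<close>-set is an arbitrary finite set. As it can be relabelled
  without changing the shape, it suffices to let \<open>S\<close> range over finite sets of naturals.\<close>

definition is_shape :: "'f set \<Rightarrow> 'f shape \<Rightarrow> bool" where
  "is_shape F w \<longleftrightarrow> (\<exists>W :: 'f \<Rightarrow> nat set. is_Fset F W \<and> w = shape_of F W)"

definition shape_le :: "'f set \<Rightarrow> 'f shape \<Rightarrow> 'f shape \<Rightarrow> bool" where
  "shape_le F z x \<longleftrightarrow> (\<forall>A. A \<subseteq> F \<longrightarrow> sh_exact z A \<le> sh_exact x A)"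

definition is_pure :: "'f set \<Rightarrow> nat \<Rightarrow> 'f shape \<Rightarrow> bool" where
  "is_pure F m w \<longleftrightarrow> (\<forall>f\<in>F. sh_inter w {f} = m)"

definition shape_prod0 :: "'f set \<Rightarrow> 'f shape \<Rightarrow> 'f shape \<Rightarrow> real" where
  "shape_prod0 F x w =
     (\<Sum>B | B \<noteq> {} \<and> B \<subseteq> F. (-1) ^ (card B - 1) * real (sh_inter x B) * real (sh_inter w B))"

definition shape_b :: "'f set \<Rightarrow> 'f shape \<Rightarrow> 'f shape \<Rightarrow> real" where
  "shape_b F x w = shape_prod0 F x w / (real (sh_total x) + real (sh_total w))"

definition sub_densities :: "'f set \<Rightarrow> 'f shape \<Rightarrow> 'f shape \<Rightarrow> real set" where
  "sub_densities F x w =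
     {shape_b F z v | z v. is_shape F z \<and> is_shape F v \<and> sh_total z > 0 \<and> sh_total v > 0 \<and>
                           shape_le F z x \<and> shape_le F v w}"

text \<open>For finite \<open>F\<close> the set \<open>sub_densities F x w\<close> is finite, and so is the set of \<open>m\<close>-pure
  shapes. If \<open>m \<ge> 1\<close>, \<open>w\<close> is \<open>m\<close>-pure and \<open>x\<close> is the shape of a
  complex, \<open>sub_densities F x w\<close> is empty only
  if the complex has no vertices; the maximum is then taken to be \<open>0\<close>.\<close>

definition max_density :: "'f set \<Rightarrow> 'f shape \<Rightarrow> 'f shape \<Rightarrow> real" where
  "max_density F x w = (if sub_densities F x w = {} then 0 else Max (sub_densities F x w))"

definition m_density :: "'f set \<Rightarrow> nat \<Rightarrow> 'f shape \<Rightarrow> real" where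
  "m_density F m x = Min {max_density F x w | w. is_shape F w \<and> is_pure F m w}"

definition complex_shape :: "'a set set \<Rightarrow> 'a set shape" where
  "complex_shape X = shape_of (facets X) (\<lambda>f. f)"

end

theory Submission
  imports Defs
begin

text \<open>A copy of \<open>X\<close> in the neighborhood complex together with a choice of \<open>m\<close> common neighbors
  \<open>W f\<close> for each facet \<open>f\<close> is an image in the graph of the bipartite graph on \<open>X\<^sub>0\<close> and \<open>W\<^sub>0\<close> with
  edge set \<open>\<Union>f. f \<times> W f\<close>, where \<open>w\<close> is \<open>m\<close>-pure; \<open>(zv)\<^sub>0\<close> counts, by inclusion-exclusion, the
  edges of an induced subgraph of it.

  Below the threshold, every such bipartite graph has an induced subgraph with parts \<open>C\<close>, \<open>D\<close>
  and more than \<open>b (|C| + |D|)\<close> edges. The images \<open>A\<close>, \<open>B\<close> of \<open>C\<close>, \<open>D\<close> in the graph may overlap,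
  but the number of edges between them is at most \<open>e(A \<union> B) + e(A \<inter> B)\<close>, so \<open>A \<union> B\<close> or \<open>A \<inter> B\<close>
  is a bounded set \<open>U\<close> of vertices of the random graph spanning more than \<open>b |U|\<close> edges, and the
  first moment method rules out such sets.

  Above the threshold, the bipartite graph of an optimal \<open>w\<close> has fewer than \<open>b |S|\<close> edges inside
  every nonempty vertex set \<open>S\<close>, and the second moment method yields an injective copy of it.\<close>

section \<open>Shapes\<close>

lemma Fset_total_finite:
  assumes "finite F" "\<forall>f\<in>F. finite (W f)"
  shows "finite (Fset_total F W)"
  using assms by (auto simp: Fset_total_def)

lemma finite_Fset_exact:
  assumes "finite F" "\<forall>f\<in>F. finite (W f)"
  shows "finite (Fset_exact F W A)"
  using Fset_total_finite[OF assms] by (auto simp: Fset_exact_def)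

lemma is_shape_obtain:
  assumes "is_shape F w"
  obtains W :: "'f \<Rightarrow> nat set" where "\<forall>f\<in>F. finite (W f)" "w = shape_of F W"
proof -
  obtain W :: "'f \<Rightarrow> nat set" and S where "finite S" "\<forall>f\<in>F. W f \<subseteq> S" "w = shape_of F W"
    using assms unfolding is_shape_def is_Fset_def by blast
  then show thesis using that[of W] by (blast intro: finite_subset)
qed

text \<open>The last hypothesis says that \<open>T\<close> is saturated for the relation of lying in
  the same sets \<open>W f\<close>. The classes of this relation are the sets
  \<open>Fset_exact F W A\<close>, so those that meet \<open>T\<close> partition it.\<close>

lemma card_eq_sum_card_exact:
  assumes "finite F" "\<forall>f\<in>F. finite (W f)" "T \<subseteq> Fset_total F W"
    "\<And>v v'. v \<in> T \<Longrightarrow> v' \<in> Fset_total F W \<Longrightarrow> {f\<in>F. v \<in> W f} = {f\<in>F. v' \<in> W f} \<Longrightarrow> v' \<in> T"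
  shows "card T = (\<Sum>A | A \<subseteq> F \<and> Fset_exact F W A \<inter> T \<noteq> {}. card (Fset_exact F W A))"
proof -
  let ?I = "{A. A \<subseteq> F \<and> Fset_exact F W A \<inter> T \<noteq> {}}"
  have "T = (\<Union>A\<in>?I. Fset_exact F W A)"
  proof (intro equalityI subsetI)
    fix v assume "v \<in> T"
    then have v: "v \<in> Fset_exact F W {f\<in>F. v \<in> W f} \<inter> T"
      using assms(3) by (auto simp: Fset_exact_def)
    then have "{f\<in>F. v \<in> W f} \<in> ?I" by auto
    then show "v \<in> (\<Union>A\<in>?I. Fset_exact F W A)" using v by (intro UN_I[of "{f\<in>F. v \<in> W f}"]) simp_all
  next
    fix v assume "v \<in> (\<Union>A\<in>?I. Fset_exact F W A)"
    then obtain A v' where A: "v \<in> Fset_exact F W A" "v' \<in> Fset_exact F W A" "v' \<in> T" by blast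
    then show "v \<in> T" using assms(4)[of v' v] by (simp add: Fset_exact_def)
  qed
  also have "card (\<Union>A\<in>?I. Fset_exact F W A) = (\<Sum>A\<in>?I. card (Fset_exact F W A))"
  proof (rule card_UN_disjoint)
    show "finite ?I" using assms(1) by simp
    show "\<forall>A\<in>?I. finite (Fset_exact F W A)"
      using finite_Fset_exact[OF assms(1,2)] by blast
    show "\<forall>A\<in>?I. \<forall>B\<in>?I. A \<noteq> B \<longrightarrow> Fset_exact F W A \<inter> Fset_exact F W B = {}"
      unfolding Fset_exact_def by blast
  qed
  finally show ?thesis .
qed

lemma card_Fset_total:
  assumes "finite F" "\<forall>f\<in>F. finite (W f)"
  shows "card (Fset_total F W) = (\<Sum>A\<in>Pow F. card (Fset_exact F W A))"
proof -
  have "card (Fset_total F W) =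
      (\<Sum>A | A \<subseteq> F \<and> Fset_exact F W A \<inter> Fset_total F W \<noteq> {}. card (Fset_exact F W A))"
    by (intro card_eq_sum_card_exact[OF assms]) auto
  also have "\<dots> = (\<Sum>A\<in>Pow F. card (Fset_exact F W A))"
  proof (rule sum.mono_neutral_left)
    have "Fset_exact F W A \<inter> Fset_total F W = Fset_exact F W A" for A
      by (auto simp: Fset_exact_def)
    then show "\<forall>A\<in>Pow F - {A. A \<subseteq> F \<and> Fset_exact F W A \<inter> Fset_total F W \<noteq> {}}.
        card (Fset_exact F W A) = 0" by simp
  qed (use assms(1) in auto)
  finally show ?thesis .
qed

text \<open>A point of exact type \<open>A\<close> lies in the intersection over \<open>B\<close>
  iff \<open>B \<subseteq> A\<close>. Together with \<open>card_Fset_total\<close> this recovers all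
  numbers entering \<open>shape_b\<close> from the exact ones, which are those that
  \<open>shape_le\<close> compares.\<close>

lemma card_Fset_inter:
  assumes "finite F" "\<forall>f\<in>F. finite (W f)" "B \<noteq> {}" "B \<subseteq> F"
  shows "card (Fset_inter F W B) = (\<Sum>A | A \<subseteq> F \<and> B \<subseteq> A. card (Fset_exact F W A))"
proof -
  have "Fset_inter F W B \<subseteq> Fset_total F W"
    using assms(3,4) by (auto simp: Fset_inter_def Fset_total_def)
  moreover have "v' \<in> Fset_inter F W B"
    if "v \<in> Fset_inter F W B" "{f\<in>F. v \<in> W f} = {f\<in>F. v' \<in> W f}" for v v'
    using that assms(3,4) by (auto simp: Fset_inter_def)
  moreover have "finite {A. A \<subseteq> F \<and> B \<subseteq> A}" using assms(1) by auto
  ultimately have "card (Fset_inter F W B) =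
      (\<Sum>A | A \<subseteq> F \<and> Fset_exact F W A \<inter> Fset_inter F W B \<noteq> {}. card (Fset_exact F W A))"
    by (intro card_eq_sum_card_exact[OF assms(1,2)]) auto
  also have "\<dots> = (\<Sum>A | A \<subseteq> F \<and> B \<subseteq> A. card (Fset_exact F W A))"
  proof (rule sum.mono_neutral_left)
    have mem: "v \<in> Fset_inter F W B \<longleftrightarrow> B \<subseteq> A" if "v \<in> Fset_exact F W A" for v A
      using that assms(3,4) by (auto simp: Fset_exact_def Fset_inter_def)
    show "{A. A \<subseteq> F \<and> Fset_exact F W A \<inter> Fset_inter F W B \<noteq> {}} \<subseteq> {A. A \<subseteq> F \<and> B \<subseteq> A}"
      using mem by blast
    show "\<forall>A\<in>{A. A \<subseteq> F \<and> B \<subseteq> A} - {A. A \<subseteq> F \<and> Fset_exact F W A \<inter> Fset_inter F W B \<noteq> {}}.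
        card (Fset_exact F W A) = 0"
    proof
      fix A
      assume A: "A \<in> {A. A \<subseteq> F \<and> B \<subseteq> A} - {A. A \<subseteq> F \<and> Fset_exact F W A \<inter> Fset_inter F W B \<noteq> {}}"
      then have "Fset_exact F W A = {}" using mem[of _ A] by blast
      then show "card (Fset_exact F W A) = 0" by simp
    qed
  qed (use assms(1) in auto)
  finally show ?thesis .
qed

lemma shape_of_simps [simp]:
  "sh_total (shape_of F W) = card (Fset_total F W)"
  "A \<subseteq> F \<Longrightarrow> sh_exact (shape_of F W) A = card (Fset_exact F W A)"
  "A \<subseteq> F \<Longrightarrow> sh_inter (shape_of F W) A = card (Fset_inter F W A)"
  by (simp_all add: shape_of_def)

text \<open>The intersection of rectangles \<open>Y f \<times> W f\<close> is the rectangle of the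
  intersected sides, so \<open>shape_prod0\<close> is the inclusion-exclusion formula for their
  union.\<close>

lemma shape_prod0_shape_of:
  fixes Y :: "'f \<Rightarrow> 's set" and W :: "'f \<Rightarrow> 't set"
  assumes "finite F" "\<forall>f\<in>F. finite (Y f)" "\<forall>f\<in>F. finite (W f)"
  shows "shape_prod0 F (shape_of F Y) (shape_of F W) = real (card (\<Union>f\<in>F. Y f \<times> W f))"
proof -
  interpret Incl_Excl finite "real \<circ> card :: ('s \<times> 't) set \<Rightarrow> real"
    by unfold_locales (auto simp: card_Un_disjnt)
  have "real (card (\<Union>f\<in>F. Y f \<times> W f)) = (\<Sum>B | B \<subseteq> F \<and> B \<noteq> {}.
          (-1) ^ (card B + 1) * real (card (\<Inter>f\<in>B. Y f \<times> W f)))"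
    using restricted_indexed[OF assms(1), of "\<lambda>f. Y f \<times> W f"] assms(2,3) by simp
  also have "\<dots> = (\<Sum>B | B \<noteq> {} \<and> B \<subseteq> F. (-1) ^ (card B - 1) *
          real (sh_inter (shape_of F Y) B) * real (sh_inter (shape_of F W) B))"
  proof (rule sum.cong)
    fix B assume B: "B \<in> {B. B \<noteq> {} \<and> B \<subseteq> F}"
    \<comment> \<open>\<open>card B + 1\<close> and the truncated difference
      \<open>card B - 1\<close> have the same parity because \<open>B\<close> is nonempty.\<close>
    then have "card B > 0" using assms(1) by (auto simp: card_gt_0_iff intro: finite_subset)
    then obtain k where k: "card B = Suc k" using gr0_conv_Suc by blast
    have "(\<Inter>f\<in>B. Y f \<times> W f) = (\<Inter>f\<in>B. Y f) \<times> (\<Inter>f\<in>B. W f)" using B by auto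
    then show "(-1) ^ (card B + 1) * real (card (\<Inter>f\<in>B. Y f \<times> W f)) = (-1) ^ (card B - 1) *
          real (sh_inter (shape_of F Y) B) * real (sh_inter (shape_of F W) B)"
      using B k by (simp add: Fset_inter_def card_cartesian_product)
  qed auto
  finally show ?thesis by (simp add: shape_prod0_def)
qed

section \<open>Restricting and relabelling F-sets\<close>

lemma Fset_total_restrict: "Fset_total F (\<lambda>f. Y f \<inter> C) = Fset_total F Y \<inter> C"
  by (auto simp: Fset_total_def)

lemma Fset_exact_restrict: "Fset_exact F (\<lambda>f. Y f \<inter> C) A = Fset_exact F Y A \<inter> C"
proof -
  have "{f \<in> F. v \<in> Y f \<and> v \<in> C} = (if v \<in> C then {f \<in> F. v \<in> Y f} else {})" for v
    by auto
  then show ?thesis unfolding Fset_exact_def Fset_total_restrict by auto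
qed

lemma shape_le_restrict:
  assumes "finite F" "\<forall>f\<in>F. finite (Y f)"
  shows "shape_le F (shape_of F (\<lambda>f. Y f \<inter> C)) (shape_of F Y)"
  using finite_Fset_exact[OF assms] by (auto simp: shape_le_def Fset_exact_restrict intro!: card_mono)

text \<open>\<open>is_shape\<close> admits only F-sets of naturals. An injection \<open>g\<close> of
  the total set into the naturals transports membership and hence all components of the
  shape.\<close>

lemma is_shape_shape_of:
  fixes Y :: "'f \<Rightarrow> 's set"
  assumes "finite F" "\<forall>f\<in>F. finite (Y f)"
  shows "is_shape F (shape_of F Y)"
proof -
  obtain g :: "'s \<Rightarrow> nat" where g: "inj_on g (Fset_total F Y)"
    using finite_imp_inj_to_nat_seg[OF Fset_total_finite[OF assms]] by metis
  define W where "W f = g ` Y f" for f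
  have sub: "Y f \<subseteq> Fset_total F Y" if "f \<in> F" for f using that by (auto simp: Fset_total_def)
  have mem: "g v \<in> W f \<longleftrightarrow> v \<in> Y f" if "v \<in> Fset_total F Y" "f \<in> F" for v f
    using that g sub[OF that(2)] by (auto simp: W_def inj_on_def)
  have tot: "Fset_total F W = g ` Fset_total F Y" by (auto simp: Fset_total_def W_def)
  have card_g: "card (g ` T) = card T" if "T \<subseteq> Fset_total F Y" for T
    using card_image inj_on_subset[OF g that] by blast
  have "Fset_exact F W A = g ` Fset_exact F Y A" for A
  proof -
    have "{f \<in> F. g v \<in> W f} = {f \<in> F. v \<in> Y f}" if "v \<in> Fset_total F Y" for v
      using mem[OF that] by auto
    then show ?thesis unfolding Fset_exact_def tot by (simp add: image_def) blast
  qed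
  moreover have "Fset_inter F W A = g ` Fset_inter F Y A" if A: "A \<subseteq> F" for A
  proof (cases "A = {}")
    case False
    then obtain f0 where f0: "f0 \<in> A" by auto
    have "(\<Inter>f\<in>A. W f) = g ` (\<Inter>f\<in>A. Y f)"
    proof (intro equalityI subsetI)
      fix u assume u: "u \<in> (\<Inter>f\<in>A. W f)"
      then obtain v where v: "v \<in> Y f0" "u = g v" using f0 by (auto simp: W_def)
      then have "v \<in> Fset_total F Y" using f0 A sub by auto
      then have "v \<in> Y f" if "f \<in> A" for f using u v mem that A by auto
      then show "u \<in> g ` (\<Inter>f\<in>A. Y f)" using v by blast
    qed (auto simp: W_def)
    then show ?thesis using False by (simp add: Fset_inter_def)
  qed (simp add: Fset_inter_def tot)
  moreover have "Fset_union W A = g ` Fset_union Y A" for A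
    by (auto simp: Fset_union_def W_def)
  moreover have "Fset_inter F Y A \<subseteq> Fset_total F Y" if "A \<subseteq> F" for A
    using that sub by (auto simp: Fset_inter_def)
  moreover have "Fset_union Y A \<subseteq> Fset_total F Y" if "A \<subseteq> F" for A
    using that sub by (auto simp: Fset_union_def)
  moreover have "Fset_exact F Y A \<subseteq> Fset_total F Y" for A
    by (auto simp: Fset_exact_def)
  ultimately have "shape_of F Y = shape_of F W"
    by (auto simp: shape_of_def tot card_g intro!: restrict_ext)
  moreover have "is_Fset F W"
    unfolding is_Fset_def using Fset_total_finite[OF assms] sub
    by (intro exI[of _ "g ` Fset_total F Y"]) (auto simp: W_def)
  ultimately show ?thesis unfolding is_shape_def by blast
qed

text \<open>A converse of \<open>shape_le_restrict\<close> for the numbers that enter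
  \<open>shape_b\<close>: in each exact part of \<open>Y\<close> keep as many points as
  \<open>z\<close> prescribes, and let \<open>C\<close> consist of the points kept.\<close>

lemma shape_le_realize:
  assumes "finite F" "\<forall>f\<in>F. finite (Y f)" "is_shape F z" "shape_le F z (shape_of F Y)"
  obtains C where "C \<subseteq> Fset_total F Y" "sh_total z = card C"
    "\<And>B. B \<noteq> {} \<Longrightarrow> B \<subseteq> F \<Longrightarrow> sh_inter z B = sh_inter (shape_of F (\<lambda>f. Y f \<inter> C)) B"
proof -
  obtain Z :: "'a \<Rightarrow> nat set" where Z: "\<forall>f\<in>F. finite (Z f)" "z = shape_of F Z"
    using is_shape_obtain[OF assms(3)] by metis
  have "\<exists>T\<subseteq>Fset_exact F Y A. card T = card (Fset_exact F Z A)" if "A \<subseteq> F" for A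
    using assms(4) that unfolding shape_le_def Z(2) by (metis obtain_subset_with_card_n shape_of_simps(2))
  then obtain D where D: "\<And>A. A \<subseteq> F \<Longrightarrow> D A \<subseteq> Fset_exact F Y A"
    "\<And>A. A \<subseteq> F \<Longrightarrow> card (D A) = card (Fset_exact F Z A)" by metis
  define C where "C = (\<Union>A\<in>Pow F. D A)"
  have C: "C \<subseteq> Fset_total F Y" 
  proof
    fix v assume "v \<in> C"
    then obtain A where "A \<subseteq> F" "v \<in> D A" by (auto simp: C_def)
    then have "v \<in> Fset_exact F Y A" using D(1) by blast
    then show "v \<in> Fset_total F Y" by (simp add: Fset_exact_def)
  qed
  have ex: "Fset_exact F (\<lambda>f. Y f \<inter> C) A = D A" if "A \<subseteq> F" for A
  proof -
    \<comment> \<open>Exact parts of different types are disjoint, so the points of \<open>C\<close>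
      of type \<open>A\<close> all come from \<open>D A\<close>.\<close>
    have "v \<in> D A" if "v \<in> Fset_exact F Y A" "v \<in> D B" "B \<subseteq> F" for v B
    proof -
      have "A = B" using that D(1)[OF that(3)] by (auto simp: Fset_exact_def)
      then show ?thesis using that by simp
    qed
    then show ?thesis unfolding Fset_exact_restrict using D(1)[OF that] that by (auto simp: C_def)
  qed
  have fin: "\<forall>f\<in>F. finite (Y f \<inter> C)" using assms(2) by auto
  show ?thesis
  proof (rule that[OF C])
    have "card C = card (Fset_total F (\<lambda>f. Y f \<inter> C))"
      using C by (simp add: Fset_total_restrict Int_absorb1)
    then show "sh_total z = card C"
      by (simp add: Z(2) card_Fset_total[OF assms(1) Z(1)] card_Fset_total[OF assms(1) fin] ex D(2))
  next
    fix B assume "B \<noteq> {}" "B \<subseteq> F"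
    then show "sh_inter z B = sh_inter (shape_of F (\<lambda>f. Y f \<inter> C)) B"
      by (simp add: Z(2) card_Fset_inter[OF assms(1) Z(1)] card_Fset_inter[OF assms(1) fin] ex D(2))
  qed
qed

section \<open>Finiteness of the ranges of the minimum and the maximum\<close>

text \<open>All numbers in a shape are cardinalities of subsets of the total set, hence at most
  \<open>N\<close>, and the three families are extensional functions on the finite set
  \<open>Pow F\<close>.\<close>

lemma finite_shapes_bounded:
  assumes "finite F"
  shows "finite {w. is_shape F w \<and> sh_total w \<le> N}"
proof -
  let ?P = "Pow F \<rightarrow>\<^sub>E {..N}"
  let ?S = "(\<lambda>(a, b, c, d). \<lparr>sh_inter = a, sh_exact = b, sh_union = c, sh_total = d\<rparr>) `
    (?P \<times> ?P \<times> ?P \<times> {..N})"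
  have "w \<in> ?S" if w: "is_shape F w" "sh_total w \<le> N" for w
  proof -
    obtain W :: "_ \<Rightarrow> nat set" where W: "\<forall>f\<in>F. finite (W f)" "w = shape_of F W"
      using is_shape_obtain[OF w(1)] by metis
    have le: "card T \<le> N" if "T \<subseteq> Fset_total F W" for T
      using card_mono[OF Fset_total_finite[OF assms W(1)] that] w(2) W(2) by simp
    show ?thesis
      unfolding W(2) shape_of_def using assms
      by (intro image_eqI[where x = "(\<lambda>A\<in>Pow F. card (Fset_inter F W A),
            \<lambda>A\<in>Pow F. card (Fset_exact F W A), \<lambda>A\<in>Pow F. card (Fset_union W A),
            card (Fset_total F W))"])
         (auto intro!: le, auto simp: Fset_inter_def Fset_exact_def Fset_union_def Fset_total_def
           split: if_splits)
  qed
  moreover have "finite ?S" using assms by (intro finite_imageI finite_cartesian_product finite_PiE) auto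
  ultimately show ?thesis by (auto intro: finite_subset)
qed

lemma finite_pure_shapes:
  assumes "finite F"
  shows "finite {w. is_shape F w \<and> is_pure F m w}"
proof (rule finite_subset[OF _ finite_shapes_bounded[OF assms]])
  have "sh_total w \<le> card F * m" if w: "is_shape F w" "is_pure F m w" for w
  proof -
    obtain W :: "_ \<Rightarrow> nat set" where W: "\<forall>f\<in>F. finite (W f)" "w = shape_of F W"
      using is_shape_obtain[OF w(1)] by metis
    have "card (W f) = m" if "f \<in> F" for f
      using w(2) that W(2) by (auto simp: is_pure_def Fset_inter_def)
    then show ?thesis using card_UN_le[OF assms, of W] by (simp add: W(2) Fset_total_def)
  qed
  then show "{w. is_shape F w \<and> is_pure F m w} \<subseteq> {w. is_shape F w \<and> sh_total w \<le> card F * m}"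
    by auto
qed

lemma sh_total_mono:
  assumes "finite F" "is_shape F z" "is_shape F x" "shape_le F z x"
  shows "sh_total z \<le> sh_total x"
proof -
  obtain Z :: "_ \<Rightarrow> nat set" where Z: "\<forall>f\<in>F. finite (Z f)" "z = shape_of F Z"
    using is_shape_obtain[OF assms(2)] by metis
  obtain Y :: "_ \<Rightarrow> nat set" where Y: "\<forall>f\<in>F. finite (Y f)" "x = shape_of F Y"
    using is_shape_obtain[OF assms(3)] by metis
  show ?thesis using assms(4)
    by (auto simp: Z(2) Y(2) card_Fset_total[OF assms(1) Z(1)] card_Fset_total[OF assms(1) Y(1)]
      shape_le_def intro!: sum_mono)
qed

lemma finite_sub_densities:
  assumes "finite F" "is_shape F x" "is_shape F w"
  shows "finite (sub_densities F x w)"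
proof (rule finite_subset)
  let ?P = "\<lambda>N. {z. is_shape F z \<and> sh_total z \<le> N}"
  show "sub_densities F x w \<subseteq> (\<lambda>(z, v). shape_b F z v) ` (?P (sh_total x) \<times> ?P (sh_total w))"
    unfolding sub_densities_def using sh_total_mono[OF assms(1)] assms(2,3) by fast
  show "finite ((\<lambda>(z, v). shape_b F z v) ` (?P (sh_total x) \<times> ?P (sh_total w)))"
    by (intro finite_imageI finite_cartesian_product finite_shapes_bounded assms(1))
qed

text \<open>Ensures that the minimum in \<open>m_density\<close> is over a nonempty set; all sets of
  the F-set may be taken equal.\<close>

lemma ex_pure_shape:
  assumes "finite F"
  shows "\<exists>w. is_shape F w \<and> is_pure F m w"
proof (intro exI conjI)
  show "is_shape F (shape_of F (\<lambda>_. {1..m}))"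
    using assms by (intro is_shape_shape_of) auto
  show "is_pure F m (shape_of F (\<lambda>_. {1..m}))"
    by (simp add: is_pure_def Fset_inter_def)
qed

text \<open>For \<open>F\<close>-sets \<open>Y\<close> and \<open>W\<close>, the number \<open>max_density\<close> is the maximal ratio of edges to
  vertices among the induced subgraphs of the bipartite graph with edge set
  \<open>\<Union>f\<in>F. Y f \<times> W f\<close>.\<close>

lemma shape_b_restrict:
  assumes "finite F" "\<forall>f\<in>F. finite (Y f)" "\<forall>f\<in>F. finite (W f)"
    and "C \<subseteq> Fset_total F Y" "D \<subseteq> Fset_total F W"
  shows "shape_b F (shape_of F (\<lambda>f. Y f \<inter> C)) (shape_of F (\<lambda>f. W f \<inter> D)) =
    real (card ((\<Union>f\<in>F. Y f \<times> W f) \<inter> C \<times> D)) / (real (card C) + real (card D))"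
proof -
  have "(\<Union>f\<in>F. (Y f \<inter> C) \<times> (W f \<inter> D)) = (\<Union>f\<in>F. Y f \<times> W f) \<inter> C \<times> D" by auto
  then show ?thesis
    using assms by (simp add: shape_b_def shape_prod0_shape_of Fset_total_restrict Int_absorb1)
qed

text \<open>A maximum over a finite nonempty set is attained, and \<open>shape_le_realize\<close>
  turns the maximizing pair of subshapes into vertex sets \<open>C\<close> and
  \<open>D\<close>.\<close>

lemma less_max_densityD:
  fixes Y :: "'f \<Rightarrow> 's set" and W :: "'f \<Rightarrow> 't set"
  assumes "finite F" "\<forall>f\<in>F. finite (Y f)" "\<forall>f\<in>F. finite (W f)"
    and "0 < b" "b < max_density F (shape_of F Y) (shape_of F W)"
  obtains C D where "C \<subseteq> Fset_total F Y" "D \<subseteq> Fset_total F W" "C \<noteq> {}" "D \<noteq> {}"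
    "b * (real (card C) + real (card D)) < real (card ((\<Union>f\<in>F. Y f \<times> W f) \<inter> C \<times> D))"
proof -
  let ?x = "shape_of F Y" and ?w = "shape_of F W"
  \<comment> \<open>Since \<open>b > 0\<close>, the default value 0 of \<open>max_density\<close>
    cannot exceed \<open>b\<close>.\<close>
  have ne: "sub_densities F ?x ?w \<noteq> {}"
    using assms(4,5) by (auto simp: max_density_def split: if_splits)
  moreover have "finite (sub_densities F ?x ?w)"
    using assms(1-3) by (intro finite_sub_densities is_shape_shape_of)
  ultimately have "max_density F ?x ?w \<in> sub_densities F ?x ?w"
    by (simp add: max_density_def)
  then obtain z v where zv: "is_shape F z" "is_shape F v" "sh_total z > 0" "sh_total v > 0"
      "shape_le F z ?x" "shape_le F v ?w" and b: "b < shape_b F z v"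
    using assms(5) unfolding sub_densities_def by fastforce
  obtain C where C: "C \<subseteq> Fset_total F Y" "sh_total z = card C"
    "\<And>B. B \<noteq> {} \<Longrightarrow> B \<subseteq> F \<Longrightarrow> sh_inter z B = sh_inter (shape_of F (\<lambda>f. Y f \<inter> C)) B"
    using shape_le_realize[OF assms(1,2) zv(1,5)] by metis
  obtain D where D: "D \<subseteq> Fset_total F W" "sh_total v = card D"
    "\<And>B. B \<noteq> {} \<Longrightarrow> B \<subseteq> F \<Longrightarrow> sh_inter v B = sh_inter (shape_of F (\<lambda>f. W f \<inter> D)) B"
    using shape_le_realize[OF assms(1,3) zv(2,6)] by metis
  have "shape_b F z v = shape_b F (shape_of F (\<lambda>f. Y f \<inter> C)) (shape_of F (\<lambda>f. W f \<inter> D))"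
    using C D by (simp add: shape_b_def shape_prod0_def Fset_total_restrict Int_absorb1)
  then have "b < real (card ((\<Union>f\<in>F. Y f \<times> W f) \<inter> C \<times> D)) / (real (card C) + real (card D))"
    using b shape_b_restrict[OF assms(1-3) C(1) D(1)] by simp
  moreover have "real (card C) + real (card D) > 0" "C \<noteq> {}" "D \<noteq> {}"
    using zv(3,4) C(2) D(2) by auto
  ultimately show ?thesis using that[OF C(1) D(1)] by (simp add: pos_less_divide_eq)
qed

lemma max_density_lessD:
  fixes Y :: "'f \<Rightarrow> 's set" and W :: "'f \<Rightarrow> 't set"
  assumes "finite F" "\<forall>f\<in>F. finite (Y f)" "\<forall>f\<in>F. finite (W f)"
    and "0 < b" "max_density F (shape_of F Y) (shape_of F W) < b"
    and C: "C \<subseteq> Fset_total F Y" and D: "D \<subseteq> Fset_total F W" and ne: "C \<noteq> {} \<or> D \<noteq> {}"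
  shows "real (card ((\<Union>f\<in>F. Y f \<times> W f) \<inter> C \<times> D)) < b * (real (card C) + real (card D))"
proof -
  let ?x = "shape_of F Y" and ?w = "shape_of F W"
  let ?z = "shape_of F (\<lambda>f. Y f \<inter> C)" and ?v = "shape_of F (\<lambda>f. W f \<inter> D)"
  have finC: "finite C" "finite D"
    using C D Fset_total_finite[of F Y] Fset_total_finite[of F W] assms(1-3)
    by (blast intro: finite_subset)+
  have "card C + card D > 0" using ne finC by (simp add: card_gt_0_iff)
  then have pos: "real (card C) + real (card D) > 0" by linarith
  show ?thesis
  \<comment> \<open>Shapes with total 0 are excluded from \<open>sub_densities\<close>. In that case
    the induced subgraph has no edges, and \<open>b > 0\<close> gives the bound.\<close>
  proof (cases "C = {} \<or> D = {}")
    case True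
    then have "(\<Union>f\<in>F. Y f \<times> W f) \<inter> C \<times> D = {}" by auto
    then show ?thesis using pos assms(4) by simp
  next
    case False
    have "is_shape F ?z" "is_shape F ?v"
      using assms(1-3) by (auto intro!: is_shape_shape_of)
    moreover have "shape_le F ?z ?x" "shape_le F ?v ?w"
      using assms(1-3) by (auto intro!: shape_le_restrict)
    moreover have "sh_total ?z > 0" "sh_total ?v > 0"
      using False finC C D by (simp_all add: Fset_total_restrict Int_absorb1 card_gt_0_iff)
    ultimately have mem: "shape_b F ?z ?v \<in> sub_densities F ?x ?w"
      unfolding sub_densities_def by blast
    moreover have "finite (sub_densities F ?x ?w)"
      using assms(1-3) by (intro finite_sub_densities is_shape_shape_of)
    ultimately have "shape_b F ?z ?v \<le> max_density F ?x ?w"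
      by (auto simp: max_density_def)
    then have "shape_b F ?z ?v < b" using assms(5) by simp
    then show ?thesis
      using pos by (simp add: shape_b_restrict[OF assms(1-3) C D] pos_divide_less_eq)
  qed
qed

section \<open>Random graphs\<close>

lemma finite_possible_edges [simp]: "finite (possible_edges n)"
  by (rule finite_subset[of _ "Pow {1..n}"]) (auto simp: possible_edges_def)

lemma set_pmf_erdos_renyi: "E \<in> set_pmf (erdos_renyi n p) \<Longrightarrow> E \<subseteq> possible_edges n"
  by (auto simp: erdos_renyi_def)

lemma prob_erdos_renyi_superset:
  assumes "0 \<le> p" "p \<le> 1" "D \<subseteq> possible_edges n"
  shows "measure_pmf.prob (erdos_renyi n p) {E. D \<subseteq> E} = p ^ card D"
proof -
  let ?P = "possible_edges n"
  \<comment> \<open>Containing \<open>D\<close> is a product event: the coordinates in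
    \<open>D\<close> are forced to be \<open>True\<close>, the others are free.\<close>
  let ?B = "\<lambda>e. if e \<in> D then {True} else UNIV"
  have "measure_pmf.prob (erdos_renyi n p) {E. D \<subseteq> E} =
      measure_pmf.prob (Pi_pmf ?P False (\<lambda>_. bernoulli_pmf p)) (Pi ?P ?B)"
    unfolding erdos_renyi_def measure_map_pmf
    by (rule arg_cong[where f = "measure_pmf.prob _"])
      (use assms(3) in \<open>auto simp: Pi_def split: if_splits\<close>)
  also have "\<dots> = (\<Prod>e\<in>?P. measure_pmf.prob (bernoulli_pmf p) (?B e))"
    by (rule measure_Pi_pmf_Pi) simp
  also have "\<dots> = (\<Prod>e\<in>?P. if e \<in> D then p else 1)"
    using assms by (intro prod.cong) (auto simp: measure_pmf_single)
  also have "\<dots> = p ^ card D"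
    using assms(3) by (simp add: prod.If_cases Int_absorb1)
  finally show ?thesis .
qed

section \<open>Second moment method\<close>

text \<open>Chebyshev's inequality for the number \<open>Z\<close> of events \<open>A i\<close> that
  occur: if none occurs, \<open>Z = 0\<close> differs from its mean by the whole mean. The numerator
  is the variance, written as a sum of covariances.\<close>

lemma second_moment_bound:
  fixes M :: "'b pmf" and A :: "'i \<Rightarrow> 'b set"
  assumes "finite I" "I \<noteq> {}" "q > 0" "\<And>i. i \<in> I \<Longrightarrow> measure_pmf.prob M (A i) = q"
  shows "measure_pmf.prob M (- (\<Union>i\<in>I. A i)) \<le>
    (\<Sum>i\<in>I. \<Sum>j\<in>I. measure_pmf.prob M (A i \<inter> A j) - q\<^sup>2) / (real (card I) * q)\<^sup>2"
proof -
  define Z :: "'b \<Rightarrow> real" where "Z x = (\<Sum>i\<in>I. indicator (A i) x)" for x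
  define \<mu> where "\<mu> = real (card I) * q"
  have Z2: "(Z x)\<^sup>2 = (\<Sum>i\<in>I. \<Sum>j\<in>I. indicator (A i \<inter> A j) x)" for x
    by (simp add: Z_def power2_eq_square sum_product indicator_inter_arith)
  have ind: "integrable (measure_pmf M) (indicator B :: 'b \<Rightarrow> real)" for B
    by (rule integrable_real_indicator) (auto simp: less_top[symmetric] measure_pmf.emeasure_eq_measure)
  have int: "integrable (measure_pmf M) Z" "integrable (measure_pmf M) (\<lambda>x. (Z x)\<^sup>2)"
    unfolding Z2 unfolding Z_def by (intro Bochner_Integration.integrable_sum ind)+
  have EZ: "measure_pmf.expectation M Z = \<mu>"
    using assms(4) by (simp add: Z_def[abs_def] ind \<mu>_def)
  have "measure_pmf.expectation M (\<lambda>x. (Z x)\<^sup>2) =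
      (\<Sum>i\<in>I. \<Sum>j\<in>I. measure_pmf.prob M (A i \<inter> A j))"
    unfolding Z2 by (simp add: ind Bochner_Integration.integrable_sum)
  then have "measure_pmf.variance M Z = (\<Sum>i\<in>I. \<Sum>j\<in>I. measure_pmf.prob M (A i \<inter> A j)) - \<mu>\<^sup>2"
    using measure_pmf.variance_eq[OF int] unfolding EZ by simp
  also have "\<dots> = (\<Sum>i\<in>I. \<Sum>j\<in>I. measure_pmf.prob M (A i \<inter> A j) - q\<^sup>2)"
    by (simp add: sum_subtractf \<mu>_def power2_eq_square)
  finally have var: "measure_pmf.variance M Z =
      (\<Sum>i\<in>I. \<Sum>j\<in>I. measure_pmf.prob M (A i \<inter> A j) - q\<^sup>2)" .
  have "\<mu> > 0" using assms by (simp add: \<mu>_def card_gt_0_iff)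
  have "Z x = 0" if "x \<notin> (\<Union>i\<in>I. A i)" for x using that by (simp add: Z_def)
  then have "measure_pmf.prob M (- (\<Union>i\<in>I. A i)) \<le>
      measure_pmf.prob M {x \<in> space M. \<bar>Z x - measure_pmf.expectation M Z\<bar> \<ge> \<mu>}"
    using \<open>\<mu> > 0\<close> by (intro measure_pmf.finite_measure_mono) (auto simp: EZ)
  also have "\<dots> \<le> measure_pmf.variance M Z / \<mu>\<^sup>2"
    using int \<open>\<mu> > 0\<close> by (intro measure_pmf.Chebyshev_inequality) auto
  finally show ?thesis unfolding var unfolding \<mu>_def .
qed

text \<open>On \<open>S\<close> the values are forced by \<open>\<psi>\<close>, and each remaining
  vertex keeps \<open>M\<close> choices. The maps may agree outside \<open>S\<close> as well, which
  makes the count an exact power.\<close>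

lemma card_PiE_agreeing:
  assumes "finite V" "S \<subseteq> V" "\<And>u. u \<in> V \<Longrightarrow> card (P u) = M" "\<psi> \<in> PiE V P"
  shows "card {\<psi>' \<in> PiE V P. \<forall>u\<in>S. \<psi> u = \<psi>' u} = M ^ (card V - card S)"
proof -
  let ?Q = "\<lambda>u. if u \<in> S then {\<psi> u} else P u"
  have "{\<psi>' \<in> PiE V P. \<forall>u\<in>S. \<psi> u = \<psi>' u} = PiE V ?Q"
  proof (intro equalityI subsetI)
    fix \<psi>' assume "\<psi>' \<in> PiE V ?Q"
    then have *: "\<psi>' u \<in> ?Q u" if "u \<in> V" for u using that by (auto simp: PiE_iff)
    have "\<psi>' u \<in> P u" if "u \<in> V" for u
      using *[OF that] PiE_mem[OF assms(4) that] by (auto split: if_splits)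
    moreover have "\<psi> u = \<psi>' u" if "u \<in> S" for u using *[of u] assms(2) that by auto
    ultimately show "\<psi>' \<in> {\<psi>' \<in> PiE V P. \<forall>u\<in>S. \<psi> u = \<psi>' u}"
      using \<open>\<psi>' \<in> PiE V ?Q\<close> by (auto simp: PiE_iff)
  qed (auto simp: PiE_iff)
  then have "card {\<psi>' \<in> PiE V P. \<forall>u\<in>S. \<psi> u = \<psi>' u} = (\<Prod>u\<in>V. if u \<in> S then 1 else M)"
    using assms(1,3) by (simp add: card_PiE if_distrib cong: if_cong)
  also have "\<dots> = M ^ card (V - S)"
    using assms(1) by (simp add: prod.If_cases Diff_eq Collect_neg_eq)
  finally show ?thesis using assms(1,2) by (simp add: card_Diff_subset finite_subset)
qed

text \<open>Restricting to the maps \<open>\<psi>\<close> that send each vertex \<open>u\<close> of \<open>H\<close> into its own part \<open>P u\<close>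
  makes all of them injective, and two copies \<open>\<psi>(H)\<close>, \<open>\<psi>'(H)\<close> then share exactly the
  edges inside the set on which \<open>\<psi>\<close> and \<open>\<psi>'\<close> agree.\<close>

lemma image_edges_inter:
  assumes "disjoint_family_on P V" "\<psi> \<in> PiE V P" "\<psi>' \<in> PiE V P" "\<And>e. e \<in> H \<Longrightarrow> e \<subseteq> V"
  shows "(`) \<psi> ` H \<inter> (`) \<psi>' ` H = (`) \<psi> ` {e \<in> H. e \<subseteq> {u \<in> V. \<psi> u = \<psi>' u}}"
proof (intro equalityI subsetI)
  fix d assume "d \<in> (`) \<psi> ` H \<inter> (`) \<psi>' ` H"
  then obtain e e' where e: "e \<in> H" "e' \<in> H" "d = \<psi> ` e" "\<psi> ` e = \<psi>' ` e'" by auto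
  have "\<psi> u = \<psi>' u" if "u \<in> e" for u
  proof -
    have "\<psi> u \<in> \<psi>' ` e'" using that unfolding e(4)[symmetric] by simp
    then obtain u' where u': "u' \<in> e'" "\<psi> u = \<psi>' u'" by auto
    then have "u \<in> V" "u' \<in> V" using e that assms(4) by auto
    then have "\<psi> u \<in> P u \<inter> P u'"
      using u' PiE_mem[OF assms(2), of u] PiE_mem[OF assms(3), of u'] by simp
    then have "u = u'" using assms(1) \<open>u \<in> V\<close> \<open>u' \<in> V\<close> by (auto simp: disjoint_family_on_def)
    then show ?thesis using u' by simp
  qed
  then show "d \<in> (`) \<psi> ` {e \<in> H. e \<subseteq> {u \<in> V. \<psi> u = \<psi>' u}}"
    using e assms(4) by blast
next
  fix d assume "d \<in> (`) \<psi> ` {e \<in> H. e \<subseteq> {u \<in> V. \<psi> u = \<psi>' u}}"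
  then obtain e where e: "e \<in> H" "e \<subseteq> {u \<in> V. \<psi> u = \<psi>' u}" "d = \<psi> ` e" by auto
  then have "\<psi> ` e = \<psi>' ` e" by (intro image_cong) auto
  then show "d \<in> (`) \<psi> ` H \<inter> (`) \<psi>' ` H" using e(1,3) by blast
qed

lemma inj_on_PiE_disjoint:
  assumes "disjoint_family_on P V" "\<psi> \<in> PiE V P"
  shows "inj_on \<psi> V"
proof (rule inj_onI)
  fix u v assume uv: "u \<in> V" "v \<in> V" "\<psi> u = \<psi> v"
  have "\<psi> u \<in> P u \<inter> P v" using PiE_mem[OF assms(2) uv(1)] PiE_mem[OF assms(2) uv(2)] uv(3) by simp
  then show "u = v" using assms(1) uv by (auto simp: disjoint_family_on_def)
qed

text \<open>Agreement on exactly \<open>S\<close> raises the probability of a pair of copies by the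
  factor \<open>1 / p ^ c S\<close>, while a proportion \<open>1 / M ^ card S\<close> of the pairs
  of maps agree on \<open>S\<close>. The product of the two is the term for
  \<open>S\<close>.\<close>

lemma prob_no_partite_copy_le:
  fixes V :: "'h set" and H :: "'h set set"
  assumes V: "finite V" and H: "\<And>e. e \<in> H \<Longrightarrow> e \<subseteq> V \<and> card e = 2"
    and P: "disjoint_family_on P V" "\<And>u. u \<in> V \<Longrightarrow> P u \<subseteq> {1..n} \<and> card (P u) = M"
    and "M > 0" and p: "0 < p" "p \<le> 1"
  shows "measure_pmf.prob (erdos_renyi n p) {E. \<not> (\<exists>\<psi>\<in>PiE V P. (`) \<psi> ` H \<subseteq> E)} \<le>
    (\<Sum>S\<in>Pow V - {{}}. 1 / (p ^ card {e \<in> H. e \<subseteq> S} * real M ^ card S))"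
proof -
  define I where "I = PiE V P"
  define c where "c S = card {e \<in> H. e \<subseteq> S}" for S
  define q where "q = p ^ card H"
  define A where "A \<psi> = {E. (`) \<psi> ` H \<subseteq> E}" for \<psi> :: "'h \<Rightarrow> nat"
  define agree where "agree \<psi> \<psi>' = {u \<in> V. \<psi> u = \<psi>' u}" for \<psi> \<psi>' :: "'h \<Rightarrow> nat"
  let ?pr = "measure_pmf.prob (erdos_renyi n p)"
  have finH: "finite H" using V H by (meson finite_Pow_iff finite_subset PowI subsetI)
  have finP: "finite (P u)" if "u \<in> V" for u using P(2)[OF that] finite_subset by blast
  have finI: "finite I" unfolding I_def using V finP by (intro finite_PiE) auto
  have cardI: "card I = M ^ card V" using V P(2) by (simp add: I_def card_PiE)
  have "I \<noteq> {}" using cardI \<open>M > 0\<close> by auto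
  have "q > 0" using p by (simp add: q_def)
  have inj: "inj_on \<psi> V" if "\<psi> \<in> I" for \<psi>
    using inj_on_PiE_disjoint[OF P(1)] that by (simp add: I_def)
  have inj': "inj_on ((`) \<psi>) H" if "\<psi> \<in> I" for \<psi>
    using inj_on_image_Pow[OF inj[OF that]] by (rule inj_on_subset) (use H in auto)
  have edges: "(`) \<psi> ` H \<subseteq> possible_edges n" if "\<psi> \<in> I" for \<psi>
  proof
    fix d assume "d \<in> (`) \<psi> ` H"
    then obtain e where e: "e \<in> H" "d = \<psi> ` e" by auto
    have "\<psi> u \<in> {1..n}" if "u \<in> V" for u
      using PiE_mem[of \<psi> V P u] P(2)[OF that] \<open>\<psi> \<in> I\<close> that unfolding I_def by blast
    moreover have "card d = 2"
      using e H[OF e(1)] card_image[OF inj_on_subset[OF inj[OF \<open>\<psi> \<in> I\<close>]]] by metis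
    ultimately show "d \<in> possible_edges n" using e H[OF e(1)] unfolding possible_edges_def by blast
  qed
  have prA: "?pr (A \<psi>) = q" if "\<psi> \<in> I" for \<psi>
    using prob_erdos_renyi_superset[OF _ p(2) edges[OF that]] p(1) card_image[OF inj'[OF that]]
    by (simp add: A_def q_def)
  \<comment> \<open>The two copies together have \<open>2 * card H\<close> edges less the shared
    ones, which are those inside the agreement set.\<close>
  have pair: "?pr (A \<psi> \<inter> A \<psi>') = q\<^sup>2 / p ^ c (agree \<psi> \<psi>')" if "\<psi> \<in> I" "\<psi>' \<in> I" for \<psi> \<psi>'
  proof -
    let ?D = "(`) \<psi> ` H" and ?D' = "(`) \<psi>' ` H"
    have "A \<psi> \<inter> A \<psi>' = {E. ?D \<union> ?D' \<subseteq> E}" by (auto simp: A_def)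
    then have pr: "?pr (A \<psi> \<inter> A \<psi>') = p ^ card (?D \<union> ?D')"
      using prob_erdos_renyi_superset[of p "?D \<union> ?D'" n] p edges that by auto
    have "card (?D \<inter> ?D') = c (agree \<psi> \<psi>')"
      using image_edges_inter[OF P(1), of \<psi> \<psi>' H] that H card_image[OF inj_on_subset[OF inj'[OF that(1)]]]
      by (simp add: I_def c_def agree_def)
    moreover have "card (?D \<union> ?D') + card (?D \<inter> ?D') = card H + card H"
      using card_Un_Int[of ?D ?D'] finH card_image[OF inj'[OF that(1)]] card_image[OF inj'[OF that(2)]]
      by simp
    ultimately have "p ^ card (?D \<union> ?D') * p ^ c (agree \<psi> \<psi>') = q\<^sup>2"
      by (simp add: q_def power2_eq_square flip: power_add)
    then show ?thesis using pr p by (simp add: field_simps)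
  qed
  have c0: "c {} = 0"
  proof -
    have "{e \<in> H. e \<subseteq> {}} = {}" using H by fastforce
    then show ?thesis by (simp add: c_def)
  qed
  let ?S = "Pow V - {{}}"
  \<comment> \<open>If the maps agree nowhere, the events are independent and the covariance
    vanishes. Otherwise the term of the agreement set is bounded by the sum over all nonempty
    \<open>S\<close> on which the maps agree, so that each \<open>S\<close> can be counted
    separately.\<close>
  have pair_le: "?pr (A \<psi> \<inter> A \<psi>') - q\<^sup>2 \<le> (\<Sum>S\<in>?S. if \<forall>u\<in>S. \<psi> u = \<psi>' u then q\<^sup>2 / p ^ c S else 0)"
    if "\<psi> \<in> I" "\<psi>' \<in> I" for \<psi> \<psi>'
  proof (cases "agree \<psi> \<psi>' = {}")
    case True
    then have "?pr (A \<psi> \<inter> A \<psi>') - q\<^sup>2 = 0" by (simp add: pair that c0)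
    also have "0 \<le> (\<Sum>S\<in>?S. if \<forall>u\<in>S. \<psi> u = \<psi>' u then q\<^sup>2 / p ^ c S else 0)"
      using p by (intro sum_nonneg) auto
    finally show ?thesis .
  next
    case False
    have "?pr (A \<psi> \<inter> A \<psi>') - q\<^sup>2 \<le> q\<^sup>2 / p ^ c (agree \<psi> \<psi>')" by (simp add: pair that)
    also have "\<dots> = (if \<forall>u\<in>agree \<psi> \<psi>'. \<psi> u = \<psi>' u then q\<^sup>2 / p ^ c (agree \<psi> \<psi>') else 0)"
      by (simp add: agree_def)
    also have "\<dots> \<le> (\<Sum>S\<in>?S. if \<forall>u\<in>S. \<psi> u = \<psi>' u then q\<^sup>2 / p ^ c S else 0)"
      by (rule member_le_sum) (use False V p in \<open>auto simp: agree_def\<close>)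
    finally show ?thesis .
  qed
  have "(\<Sum>\<psi>\<in>I. \<Sum>\<psi>'\<in>I. ?pr (A \<psi> \<inter> A \<psi>') - q\<^sup>2) \<le>
      (\<Sum>\<psi>\<in>I. \<Sum>\<psi>'\<in>I. \<Sum>S\<in>?S. if \<forall>u\<in>S. \<psi> u = \<psi>' u then q\<^sup>2 / p ^ c S else 0)"
    by (intro sum_mono pair_le)
  also have "\<dots> = (\<Sum>\<psi>\<in>I. \<Sum>S\<in>?S. \<Sum>\<psi>'\<in>I. if \<forall>u\<in>S. \<psi> u = \<psi>' u then q\<^sup>2 / p ^ c S else 0)"
    by (intro sum.cong refl sum.swap)
  also have "\<dots> = (\<Sum>\<psi>\<in>I. \<Sum>S\<in>?S. real (M ^ (card V - card S)) * (q\<^sup>2 / p ^ c S))"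
  proof (intro sum.cong refl)
    fix \<psi> S assume "\<psi> \<in> I" "S \<in> ?S"
    then have "card {\<psi>' \<in> I. \<forall>u\<in>S. \<psi> u = \<psi>' u} = M ^ (card V - card S)"
      unfolding I_def using V P(2) by (intro card_PiE_agreeing) auto
    then show "(\<Sum>\<psi>'\<in>I. if \<forall>u\<in>S. \<psi> u = \<psi>' u then q\<^sup>2 / p ^ c S else 0) =
        real (M ^ (card V - card S)) * (q\<^sup>2 / p ^ c S)"
      by (simp flip: sum.inter_filter[OF finI])
  qed
  \<comment> \<open>The squared expected number of copies is factored out, to be cancelled by the
    denominator of the second moment bound.\<close>
  also have "\<dots> = (\<Sum>S\<in>?S. (real M ^ card V * q)\<^sup>2 * (1 / (p ^ c S * real M ^ card S)))"
  proof -
    have "real M ^ card V * (real M ^ (card V - card S) * (q\<^sup>2 / p ^ c S)) =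
      (real M ^ card V * q)\<^sup>2 * (1 / (p ^ c S * real M ^ card S))" if "S \<in> ?S" for S
    proof -
      have "card S \<le> card V" using that V by (auto intro: card_mono)
      then have "real M ^ (card V - card S) = real M ^ card V / real M ^ card S"
        using \<open>M > 0\<close> by (simp add: power_diff)
      then show ?thesis by (simp add: power2_eq_square field_simps)
    qed
    then show ?thesis by (simp add: cardI sum_distrib_left)
  qed
  also have "\<dots> = (real (card I) * q)\<^sup>2 * (\<Sum>S\<in>?S. 1 / (p ^ c S * real M ^ card S))"
    by (simp add: cardI sum_distrib_left)
  finally have "(\<Sum>\<psi>\<in>I. \<Sum>\<psi>'\<in>I. ?pr (A \<psi> \<inter> A \<psi>') - q\<^sup>2) / (real (card I) * q)\<^sup>2 \<le>
      (\<Sum>S\<in>?S. 1 / (p ^ c S * real M ^ card S))"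
    using \<open>q > 0\<close> \<open>M > 0\<close> cardI by (subst pos_divide_le_eq) (auto simp: mult.commute)
  moreover have "?pr (- (\<Union>\<psi>\<in>I. A \<psi>)) \<le>
      (\<Sum>\<psi>\<in>I. \<Sum>\<psi>'\<in>I. ?pr (A \<psi> \<inter> A \<psi>') - q\<^sup>2) / (real (card I) * q)\<^sup>2"
    by (rule second_moment_bound[OF finI \<open>I \<noteq> {}\<close> \<open>q > 0\<close> prA])
  moreover have "- (\<Union>\<psi>\<in>I. A \<psi>) = {E. \<not> (\<exists>\<psi>\<in>PiE V P. (`) \<psi> ` H \<subseteq> E)}"
    by (auto simp: A_def I_def)
  ultimately show ?thesis unfolding c_def by simp
qed

section \<open>Asymptotics at edge probability \<open>n powr (- 1 / b)\<close>\<close>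

lemma powr_minus_inverse_bounds:
  assumes "n \<ge> 1" "b > 0"
  shows "0 < real n powr (- 1 / b)" "real n powr (- 1 / b) \<le> 1"
  using assms powr_mono[of "- 1 / b" 0 "real n"] by auto

lemma powr_minus_inverse_power:
  assumes "n \<ge> 1"
  shows "(real n powr (- 1 / b)) ^ k = 1 / real n powr (real k / b)"
proof -
  have "(real n powr (- 1 / b)) ^ k = real n powr (- 1 / b * real k)"
    by (subst powr_powr[symmetric]) (use assms in \<open>simp add: powr_realpow\<close>)
  also have "- 1 / b * real k = - (real k / b)" by simp
  finally show ?thesis by (simp only: powr_minus_divide)
qed

lemma tendsto_powr_neg_nat:
  assumes "a < (0::real)"
  shows "(\<lambda>n. real n powr a) \<longlonglongrightarrow> 0"
  using tendsto_neg_powr[OF assms filterlim_real_sequentially] .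

text \<open>With parts of size \<open>M\<close> proportional to \<open>n\<close>, the term for
  \<open>S\<close> in \<open>prob_no_partite_copy_le\<close> is at most a constant times
  \<open>n\<close> to the power \<open>c S / b - card S\<close>, and \<open>sparse\<close> makes
  this exponent negative.\<close>

lemma graph_appears_above_threshold:
  fixes V :: "'h set" and H :: "'h set set"
  assumes V: "finite V" and H: "\<And>e. e \<in> H \<Longrightarrow> e \<subseteq> V \<and> card e = 2" and "b > 0"
    and sparse: "\<And>S. S \<subseteq> V \<Longrightarrow> S \<noteq> {} \<Longrightarrow> real (card {e \<in> H. e \<subseteq> S}) < b * real (card S)"
  shows "(\<lambda>n. measure_pmf.prob (erdos_renyi n (real n powr (- 1 / b)))
    {E. \<exists>\<psi>. inj_on \<psi> V \<and> \<psi> ` V \<subseteq> {1..n} \<and> (`) \<psi> ` H \<subseteq> E}) \<longlonglongrightarrow> 1"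
proof -
  \<comment> \<open>One more than the number of vertices, so that \<open>v > 0\<close> also for
    empty \<open>V\<close>.\<close>
  define v where "v = Suc (card V)"
  define c where "c S = card {e \<in> H. e \<subseteq> S}" for S
  let ?pr = "\<lambda>n. measure_pmf.prob (erdos_renyi n (real n powr (- 1 / b)))"
  let ?G = "\<lambda>n. {E. \<exists>\<psi>. inj_on \<psi> V \<and> \<psi> ` V \<subseteq> {1..n} \<and> (`) \<psi> ` H \<subseteq> E}"
  \<comment> \<open>The constant \<open>2 * real v\<close> comes from the bound
    \<open>n / (2 * v) \<le> n div v\<close>, valid once \<open>n \<ge> 2 * v\<close>.\<close>
  let ?bd = "\<lambda>n. \<Sum>S\<in>Pow V - {{}}. (2 * real v) ^ card S * real n powr (real (c S) / b - real (card S))"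
  have "?bd \<longlonglongrightarrow> (\<Sum>S\<in>Pow V - {{}}. (2 * real v) ^ card S * 0)"
  proof (intro tendsto_sum tendsto_mult tendsto_const tendsto_powr_neg_nat)
    fix S assume "S \<in> Pow V - {{}}"
    then show "real (c S) / b - real (card S) < 0"
      using sparse[of S] \<open>b > 0\<close> by (simp add: c_def field_simps)
  qed
  then have lim: "(\<lambda>n. 1 - ?bd n) \<longlonglongrightarrow> 1"
    using tendsto_diff[OF tendsto_const] by fastforce
  obtain idx where idx: "inj_on idx V" "idx ` V = {i::nat. i < card V}"
    using finite_imp_inj_to_nat_seg[OF V] by (metis card_Collect_less_nat card_image)
  have "1 - ?bd n \<le> ?pr n (?G n)" if n: "n \<ge> 2 * v" for n
  proof -
    define p where "p = real n powr (- 1 / b)"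
    define M where "M = n div v"
    \<comment> \<open>Consecutive blocks of length \<open>M\<close>, one per vertex; the shift by 1
      is there because \<open>idx\<close> starts at 0 and the graph lives on
      \<open>{1..n}\<close>.\<close>
    define P where "P u = {idx u * M + 1 .. idx u * M + M}" for u
    have "v > 0" by (simp add: v_def)
    then have "n \<ge> 1" using n by linarith
    have p: "0 < p" "p \<le> 1" using powr_minus_inverse_bounds[OF \<open>n \<ge> 1\<close> \<open>b > 0\<close>] by (auto simp: p_def)
    have "2 \<le> M" using n \<open>v > 0\<close> by (simp add: M_def less_eq_div_iff_mult_less_eq)
    have "n < (M + 1) * v" unfolding M_def using \<open>v > 0\<close>
      by (metis Suc_eq_plus1 dividend_less_div_times mult.commute mult_Suc add.commute)
    also have "\<dots> \<le> 2 * M * v" using \<open>2 \<le> M\<close> by simp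
    finally have "n \<le> 2 * M * v" by simp
    then have "real n \<le> 2 * real M * real v" by (metis of_nat_le_iff of_nat_mult of_nat_numeral)
    then have Mn: "real n / (2 * real v) \<le> real M" using \<open>v > 0\<close> by (simp add: field_simps)
    have disj: "disjoint_family_on P V"
      unfolding disjoint_family_on_def
    proof (intro ballI impI)
      fix u u' assume u: "u \<in> V" "u' \<in> V" "u \<noteq> u'"
      have "P u \<inter> P u' = {}" if "idx u < idx u'" for u u'
      proof -
        have "idx u * M + M \<le> idx u' * M" using mult_le_mono1[of "Suc (idx u)" "idx u'" M] that by simp
        then show ?thesis by (auto simp: P_def)
      qed
      moreover have "idx u \<noteq> idx u'" using u idx(1) by (auto simp: inj_on_def)
      ultimately show "P u \<inter> P u' = {}" by (metis Int_commute linorder_neqE_nat)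
    qed
    have P: "P u \<subseteq> {1..n} \<and> card (P u) = M" if "u \<in> V" for u
    proof -
      have "idx u < card V" using idx(2) that by blast
      then have "idx u * M + M \<le> v * M" using mult_le_mono1[of "Suc (idx u)" v M] by (simp add: v_def)
      also have "\<dots> \<le> n" by (simp add: M_def)
      finally show ?thesis by (auto simp: P_def)
    qed
    let ?N = "{E. \<not> (\<exists>\<psi>\<in>PiE V P. (`) \<psi> ` H \<subseteq> E)}"
    have "?pr n ?N \<le>
        (\<Sum>S\<in>Pow V - {{}}. 1 / (p ^ c S * real M ^ card S))"
      unfolding c_def p_def[symmetric] using disj P \<open>2 \<le> M\<close> p
      by (intro prob_no_partite_copy_le[OF V H]) auto
    also have "\<dots> \<le> ?bd n"
    proof (intro sum_mono)
      fix S
      have pc: "p ^ c S = 1 / real n powr (real (c S) / b)"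
        using powr_minus_inverse_power[OF \<open>n \<ge> 1\<close>] by (simp add: p_def)
      have "(real n / (2 * real v)) ^ card S \<le> real M ^ card S"
        using Mn by (intro power_mono) auto
      then have "1 / (p ^ c S * real M ^ card S) \<le> 1 / (p ^ c S * (real n / (2 * real v)) ^ card S)"
        using p \<open>2 \<le> M\<close> \<open>n \<ge> 1\<close> \<open>v > 0\<close> by (intro divide_left_mono mult_left_mono) auto
      also have "\<dots> = (2 * real v) ^ card S * (real n powr (real (c S) / b) / real n ^ card S)"
        by (simp add: pc power_divide)
      also have "\<dots> = (2 * real v) ^ card S * real n powr (real (c S) / b - real (card S))"
        using \<open>n \<ge> 1\<close> by (simp add: powr_diff powr_realpow)
      finally show "1 / (p ^ c S * real M ^ card S) \<le>
          (2 * real v) ^ card S * real n powr (real (c S) / b - real (card S))" .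
    qed
    finally have "?pr n ?N \<le> ?bd n" .
    moreover have "?pr n (- ?N) \<le> ?pr n (?G n)"
    proof (intro measure_pmf.finite_measure_mono subsetI)
      fix E assume "E \<in> - ?N"
      then obtain \<psi> where \<psi>: "\<psi> \<in> PiE V P" "(`) \<psi> ` H \<subseteq> E" by auto
      have "\<psi> ` V \<subseteq> {1..n}" using PiE_mem[OF \<psi>(1)] P by blast
      then show "E \<in> ?G n"
        using inj_on_PiE_disjoint[OF disj \<psi>(1)] \<psi>(2) by auto
    qed auto
    moreover have "?pr n (- ?N) = 1 - ?pr n ?N"
      using measure_pmf.prob_compl[of ?N "erdos_renyi n (real n powr (- 1 / b))"]
      by (simp add: Compl_eq_Diff_UNIV)
    ultimately show ?thesis by linarith
  qed
  then have "eventually (\<lambda>n. 1 - ?bd n \<le> ?pr n (?G n)) sequentially"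
    unfolding eventually_sequentially by blast
  then show ?thesis
    by (rule tendsto_sandwich[OF _ _ lim tendsto_const]) (simp add: always_eventually)
qed

section \<open>First moment method\<close>

text \<open>Union bound over at most \<open>n ^ k\<close> vertex sets \<open>U\<close> and, inside
  each, over the sets of exactly \<open>l\<close> edges. These are counted crudely among all sets of
  subsets of \<open>U\<close>, as the constant only has to be independent of
  \<open>n\<close>.\<close>

lemma prob_dense_subset_le:
  assumes p: "0 \<le> p" "p \<le> 1"
  shows "measure_pmf.prob (erdos_renyi n p)
      {E. E \<subseteq> possible_edges n \<and> (\<exists>U\<subseteq>{1..n}. card U = k \<and> l \<le> card {e \<in> E. e \<subseteq> U})}
    \<le> 2 ^ 2 ^ k * (real n ^ k * p ^ l)"
proof -
  let ?pr = "measure_pmf.prob (erdos_renyi n p)"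
  define T where "T = {U. U \<subseteq> {1..n} \<and> card U = k}"
  define Q where "Q U = {D. D \<subseteq> possible_edges n \<inter> Pow U \<and> card D = l}" for U
  have finT: "finite T" by (simp add: T_def)
  have finQ: "finite (Q U)" for U by (simp add: Q_def)
  have cardT: "real (card T) \<le> real n ^ k"
  proof (cases "k \<le> n")
    case True
    then show ?thesis using binomial_le_pow[OF True] by (simp add: T_def n_subsets flip: of_nat_power)
  qed (simp add: T_def n_subsets binomial_eq_0)
  have cardQ: "real (card (Q U)) \<le> 2 ^ 2 ^ k" if "U \<in> T" for U
  proof -
    have "finite U" "card U = k" using that finite_subset by (auto simp: T_def)
    moreover have "Q U \<subseteq> Pow (Pow U)" by (auto simp: Q_def)
    ultimately have "card (Q U) \<le> 2 ^ 2 ^ k" using card_mono[of "Pow (Pow U)" "Q U"] by (simp add: card_Pow)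
    then show ?thesis by (metis of_nat_le_iff of_nat_numeral of_nat_power)
  qed
  have "{E. E \<subseteq> possible_edges n \<and> (\<exists>U\<subseteq>{1..n}. card U = k \<and> l \<le> card {e \<in> E. e \<subseteq> U})}
      \<subseteq> (\<Union>U\<in>T. \<Union>D\<in>Q U. {E. D \<subseteq> E})"
  proof
    fix E assume "E \<in> {E. E \<subseteq> possible_edges n \<and> (\<exists>U\<subseteq>{1..n}. card U = k \<and> l \<le> card {e \<in> E. e \<subseteq> U})}"
    then obtain U where U: "E \<subseteq> possible_edges n" "U \<subseteq> {1..n}" "card U = k" "l \<le> card {e \<in> E. e \<subseteq> U}"
      by auto
    then obtain D where "D \<subseteq> {e \<in> E. e \<subseteq> U}" "card D = l" by (meson obtain_subset_with_card_n)
    then have "D \<in> Q U" "D \<subseteq> E" "U \<in> T" using U by (auto simp: Q_def T_def)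
    then show "E \<in> (\<Union>U\<in>T. \<Union>D\<in>Q U. {E. D \<subseteq> E})" by blast
  qed
  then have "?pr {E. E \<subseteq> possible_edges n \<and> (\<exists>U\<subseteq>{1..n}. card U = k \<and> l \<le> card {e \<in> E. e \<subseteq> U})}
      \<le> ?pr (\<Union>U\<in>T. \<Union>D\<in>Q U. {E. D \<subseteq> E})"
    by (intro measure_pmf.finite_measure_mono) auto
  also have "\<dots> \<le> (\<Sum>U\<in>T. ?pr (\<Union>D\<in>Q U. {E. D \<subseteq> E}))"
    using finT by (intro measure_pmf.finite_measure_subadditive_finite) auto
  also have "\<dots> \<le> (\<Sum>U\<in>T. \<Sum>D\<in>Q U. ?pr {E. D \<subseteq> E})"
    using finQ by (intro sum_mono measure_pmf.finite_measure_subadditive_finite) auto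
  also have "\<dots> = (\<Sum>U\<in>T. \<Sum>D\<in>Q U. p ^ l)"
    using p by (intro sum.cong refl, subst prob_erdos_renyi_superset) (auto simp: Q_def)
  also have "\<dots> \<le> (\<Sum>U\<in>T. 2 ^ 2 ^ k * p ^ l)"
    using cardQ p by (intro sum_mono) (simp add: mult_right_mono)
  also have "\<dots> \<le> real n ^ k * (2 ^ 2 ^ k * p ^ l)"
    using mult_right_mono[OF cardT, of "2 ^ 2 ^ k * p ^ l"] p by simp
  finally show ?thesis by (simp add: mult_ac)
qed

text \<open>Only the sizes \<open>k \<le> N\<close> occur, so it suffices that each union bound, a
  constant times \<open>n\<close> to the power \<open>k - l k / b\<close>, tends to 0. The exponent
  is negative because \<open>l k > b * k\<close>.\<close>

lemma dense_subset_below_threshold: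
  assumes "b > 0"
  shows "(\<lambda>n. measure_pmf.prob (erdos_renyi n (real n powr (- 1 / b)))
    {E. E \<subseteq> possible_edges n \<and> (\<exists>U\<subseteq>{1..n}. U \<noteq> {} \<and> card U \<le> N \<and>
      b * real (card U) < real (card {e \<in> E. e \<subseteq> U}))}) \<longlonglongrightarrow> 0"
proof -
  \<comment> \<open>The least integer strictly above \<open>b * k\<close>: floor plus 1 and not the
    ceiling, since the inequality must be strict also when \<open>b * k\<close> is an
    integer.\<close>
  define l where "l k = nat \<lfloor>b * real k\<rfloor> + 1" for k :: nat
  have l: "b * real k < real (l k)" "b * real k < real j \<Longrightarrow> l k \<le> j" for k j :: nat
  proof -
    have "\<lfloor>b * real k\<rfloor> \<ge> 0" using assms by simp
    then have lk: "int (l k) = \<lfloor>b * real k\<rfloor> + 1" by (simp add: l_def)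
    then have "real (l k) = real_of_int (\<lfloor>b * real k\<rfloor> + 1)" by linarith
    then show "b * real k < real (l k)" by simp
    assume "b * real k < real j"
    then have "\<lfloor>b * real k\<rfloor> < int j" by (simp add: floor_less_iff)
    then show "l k \<le> j" using lk by linarith
  qed
  let ?pr = "\<lambda>n. measure_pmf.prob (erdos_renyi n (real n powr (- 1 / b)))"
  let ?A = "\<lambda>n. {E. E \<subseteq> possible_edges n \<and> (\<exists>U\<subseteq>{1..n}. U \<noteq> {} \<and> card U \<le> N \<and>
      b * real (card U) < real (card {e \<in> E. e \<subseteq> U}))}"
  let ?B = "\<lambda>n k. {E. E \<subseteq> possible_edges n \<and>
      (\<exists>U\<subseteq>{1..n}. card U = k \<and> l k \<le> card {e \<in> E. e \<subseteq> U})}"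
  let ?bd = "\<lambda>n. \<Sum>k\<in>{1..N}. 2 ^ 2 ^ k * real n powr (real k - real (l k) / b)"
  have "?bd \<longlonglongrightarrow> (\<Sum>k\<in>{1..N}. 2 ^ 2 ^ k * 0)"
    using l(1) assms
    by (intro tendsto_sum tendsto_mult tendsto_const tendsto_powr_neg_nat) (simp add: field_simps)
  then have lim: "?bd \<longlonglongrightarrow> 0" by simp
  have "?pr n (?A n) \<le> ?bd n" if "n \<ge> 1" for n
  proof -
    note p = powr_minus_inverse_bounds[OF that assms]
    have "?A n \<subseteq> (\<Union>k\<in>{1..N}. ?B n k)"
    proof
      fix E assume "E \<in> ?A n"
      then obtain U where U: "E \<subseteq> possible_edges n" "U \<subseteq> {1..n}" "U \<noteq> {}" "card U \<le> N"
        "b * real (card U) < real (card {e \<in> E. e \<subseteq> U})" by auto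
      have "finite U" using U(2) finite_subset by blast
      then have "card U \<in> {1..N}" using U(3,4) by (simp add: Suc_le_eq card_gt_0_iff)
      then show "E \<in> (\<Union>k\<in>{1..N}. ?B n k)" using U(1,2) l(2)[OF U(5)] by blast
    qed
    then have "?pr n (?A n) \<le> ?pr n (\<Union>k\<in>{1..N}. ?B n k)"
      by (intro measure_pmf.finite_measure_mono) auto
    also have "\<dots> \<le> (\<Sum>k\<in>{1..N}. ?pr n (?B n k))"
      by (intro measure_pmf.finite_measure_subadditive_finite) auto
    also have "\<dots> \<le> (\<Sum>k\<in>{1..N}. 2 ^ 2 ^ k * (real n ^ k * (real n powr (- 1 / b)) ^ l k))"
      using p by (intro sum_mono prob_dense_subset_le) auto
    also have "\<dots> = ?bd n"
      unfolding powr_minus_inverse_power[OF that] using that by (simp add: powr_diff powr_realpow)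
    finally show ?thesis .
  qed
  then have "eventually (\<lambda>n. ?pr n (?A n) \<le> ?bd n) sequentially"
    unfolding eventually_sequentially by blast
  then show ?thesis
    by (intro tendsto_sandwich[OF _ _ tendsto_const lim]) (auto simp: always_eventually)
qed

text \<open>Forgetting the order identifies \<open>(a, c)\<close> only with \<open>(c, a)\<close>,
  and both belong to \<open>A \<times> B\<close> only if \<open>a\<close> and \<open>c\<close> lie
  in \<open>A \<inter> B\<close>. So edges inside the intersection count at most twice, all others
  at most once.\<close>

lemma card_pairs_le:
  fixes A B :: "'v::linorder set"
  assumes "finite E" "\<And>e. e \<in> E \<Longrightarrow> card e = 2"
  shows "card {(a, c) \<in> A \<times> B. {a, c} \<in> E} \<le>
    card {e \<in> E. e \<subseteq> A \<union> B} + card {e \<in> E. e \<subseteq> A \<inter> B}"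
proof -
  define R where "R = {(a, c) \<in> A \<times> B. {a, c} \<in> E}"
  \<comment> \<open>The linear order selects one orientation of each edge inside
    \<open>A \<inter> B\<close>; these pairs are charged to the second summand.\<close>
  define R2 where "R2 = {(a, c) \<in> R. a \<in> A \<inter> B \<and> c \<in> A \<inter> B \<and> a > c}"
  let ?h = "\<lambda>(a, c). {a, c}"
  have neq: "a \<noteq> c" if "(a, c) \<in> R" for a c using assms(2)[of "{a, c}"] that by (auto simp: R_def)
  have inj2: "inj_on ?h R2" by (auto simp: inj_on_def R2_def doubleton_eq_iff)
  have inj1: "inj_on ?h (R - R2)"
  proof (rule inj_onI, clarify)
    fix a c a' c'
    assume *: "(a, c) \<in> R" "(a, c) \<notin> R2" "(a', c') \<in> R" "(a', c') \<notin> R2" "{a, c} = {a', c'}"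
    then consider "a = a'" "c = c'" | "a = c'" "c = a'" by (auto simp: doubleton_eq_iff)
    then show "a = a' \<and> c = c'"
    proof cases
      case 2
      then have "a \<in> A \<inter> B" "c \<in> A \<inter> B" using * by (auto simp: R_def)
      then have "\<not> a > c" "\<not> c > a" using * 2 by (auto simp: R2_def)
      then show ?thesis using neq[OF *(1)] by auto
    qed auto
  qed
  have "finite (?h ` R2)" "finite (?h ` (R - R2))"
    using assms(1) by (auto intro!: finite_subset[OF _ assms(1)] simp: R_def R2_def)
  then have fin: "finite R2" "finite (R - R2)"
    using inj1 inj2 by (auto dest: finite_imageD)
  have "card R \<le> card (R - R2) + card R2"
    using card_Un_le[of "R - R2" R2] by (simp add: R2_def Un_absorb2 Collect_mono_iff subset_iff)
  also have "\<dots> = card (?h ` (R - R2)) + card (?h ` R2)"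
    using card_image[OF inj1] card_image[OF inj2] by simp
  also have "\<dots> \<le> card {e \<in> E. e \<subseteq> A \<union> B} + card {e \<in> E. e \<subseteq> A \<inter> B}"
    using assms(1) by (intro add_mono card_mono) (auto simp: R_def R2_def)
  finally show ?thesis by (simp add: R_def)
qed

section \<open>The threshold\<close>

lemma ex_facet_superset:
  assumes "finite X" "f \<in> X"
  obtains g where "g \<in> facets X" "f \<subseteq> g"
proof -
  obtain g where "g \<in> X" "f \<subseteq> g" "\<forall>h\<in>X. g \<subseteq> h \<longrightarrow> g = h"
    using finite_has_maximal2[OF assms] by metis
  then show thesis using that[of g] by (auto simp: facets_def)
qed

lemma Fset_total_facets:
  assumes "finite X"
  shows "Fset_total (facets X) (\<lambda>f. f) = vertices X"
proof
  show "vertices X \<subseteq> Fset_total (facets X) (\<lambda>f. f)"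
  proof
    fix v assume "v \<in> vertices X"
    then obtain f where f: "f \<in> X" "v \<in> f" by (auto simp: vertices_def)
    obtain g where "g \<in> facets X" "f \<subseteq> g" using ex_facet_superset[OF assms f(1)] by metis
    then show "v \<in> Fset_total (facets X) (\<lambda>f. f)" using f(2) by (auto simp: Fset_total_def)
  qed
qed (auto simp: Fset_total_def vertices_def facets_def)

lemma m_density_le:
  assumes "finite F" "is_shape F w" "is_pure F m w"
  shows "m_density F m x \<le> max_density F x w"
proof -
  have "finite {max_density F x w | w. is_shape F w \<and> is_pure F m w}"
    by (intro finite_image_set finite_pure_shapes assms(1))
  then show ?thesis unfolding m_density_def using assms by (intro Min_le) auto
qed

lemma m_density_attained:
  assumes "finite F"
  obtains w where "is_shape F w" "is_pure F m w" "m_density F m x = max_density F x w"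
proof -
  let ?D = "{max_density F x w | w. is_shape F w \<and> is_pure F m w}"
  have "finite ?D" by (intro finite_image_set finite_pure_shapes assms)
  moreover have "?D \<noteq> {}" using ex_pure_shape[OF assms] by blast
  ultimately have "m_density F m x \<in> ?D" unfolding m_density_def by (rule Min_in)
  then show thesis using that by blast
qed

section \<open>Below the threshold\<close>

text \<open>The deterministic half: a choice of \<open>m\<close> common neighbors per facet is an
  \<open>m\<close>-pure F-set, so its \<open>max_density\<close> is at least
  \<open>m_density\<close> and exceeds \<open>b\<close>.\<close>

lemma copy_imp_dense_subset:
  fixes X :: "'a set set"
  assumes X: "abstract_simplicial_complex X" "finite X" and "b > 0"
    and b: "b < m_density (facets X) m (complex_shape X)"
    and E: "E \<subseteq> possible_edges n"
    and copy: "contains_copy (neighborhood_complex m {1..n} E) X"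
  shows "\<exists>U\<subseteq>{1..n}. U \<noteq> {} \<and> card U \<le> card (vertices X) + card (facets X) * m \<and>
    b * real (card U) < real (card {e \<in> E. e \<subseteq> U})"
proof -
  let ?F = "facets X"
  have F: "finite ?F" "\<forall>f\<in>?F. finite f" "\<And>f. f \<in> ?F \<Longrightarrow> f \<in> X"
    using X by (auto simp: facets_def abstract_simplicial_complex_def)
  have fin_vert: "finite (vertices X)"
    using X by (auto simp: vertices_def abstract_simplicial_complex_def)
  have E2: "finite E" "\<And>e. e \<in> E \<Longrightarrow> card e = 2"
    using E by (auto intro: finite_subset simp: possible_edges_def)
  obtain \<phi> where \<phi>: "inj_on \<phi> (vertices X)" "\<forall>f\<in>X. \<phi> ` f \<in> neighborhood_complex m {1..n} E"
    using copy unfolding contains_copy_def by blast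
  \<comment> \<open>Exactly \<open>m\<close> common neighbors are kept for each facet, since purity
    demands equality.\<close>
  have "\<exists>T\<subseteq>common_neighbors {1..n} E (\<phi> ` f). card T = m \<and> finite T" if "f \<in> ?F" for f
  proof -
    have "m \<le> card (common_neighbors {1..n} E (\<phi> ` f))"
      using \<phi>(2) F(3)[OF that] by (auto simp: neighborhood_complex_def)
    then show ?thesis by (meson obtain_subset_with_card_n)
  qed
  then obtain W where W: "\<And>f. f \<in> ?F \<Longrightarrow> W f \<subseteq> common_neighbors {1..n} E (\<phi> ` f)"
    "\<And>f. f \<in> ?F \<Longrightarrow> card (W f) = m" "\<forall>f\<in>?F. finite (W f)" by metis
  have "is_pure ?F m (shape_of ?F W)"
    using W(2) by (simp add: is_pure_def Fset_inter_def)
  then have b_max: "b < max_density ?F (shape_of ?F (\<lambda>f. f)) (shape_of ?F W)"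
    using b m_density_le[OF F(1) is_shape_shape_of[OF F(1) W(3)], of m "complex_shape X"]
    by (simp add: complex_shape_def)
  obtain C D where C: "C \<subseteq> Fset_total ?F (\<lambda>f. f)" and D: "D \<subseteq> Fset_total ?F W"
    and "C \<noteq> {}" "D \<noteq> {}" and dense: "b * (real (card C) + real (card D)) < real (card ((\<Union>f\<in>?F. f \<times> W f) \<inter> C \<times> D))"
    by (rule less_max_densityD[OF F(1,2) W(3) \<open>b > 0\<close> b_max])
  have C': "C \<subseteq> vertices X" using C by (simp add: Fset_total_facets[OF X(2)])
  define A where "A = \<phi> ` C"
  let ?e = "\<lambda>U. card {e \<in> E. e \<subseteq> U}"
  have inj: "inj_on \<phi> C" using \<phi>(1) C' by (rule inj_on_subset)
  have cardA: "card A = card C" by (simp add: A_def card_image inj)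
  have finA: "finite A" using finite_subset[OF C' fin_vert] by (simp add: A_def)
  have A: "A \<subseteq> {1..n}"
    using C' \<phi>(2) by (auto simp: A_def vertices_def neighborhood_complex_def)
  have D': "D \<subseteq> {1..n}" using D W(1) by (fastforce simp: Fset_total_def common_neighbors_def)
  then have finD: "finite D" using finite_subset by blast
  \<comment> \<open>Edges of the bipartite graph become adjacent ordered pairs, and no two of them
    collide because \<open>\<phi>\<close> is injective on \<open>C\<close>.\<close>
  have "card ((\<Union>f\<in>?F. f \<times> W f) \<inter> C \<times> D) \<le> card {(a, c) \<in> A \<times> D. {a, c} \<in> E}"
  proof (rule card_inj_on_le[where f = "map_prod \<phi> id"])
    show "inj_on (map_prod \<phi> id) ((\<Union>f\<in>?F. f \<times> W f) \<inter> C \<times> D)"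
      using inj by (auto simp: inj_on_def)
    show "map_prod \<phi> id ` ((\<Union>f\<in>?F. f \<times> W f) \<inter> C \<times> D) \<subseteq> {(a, c) \<in> A \<times> D. {a, c} \<in> E}"
      using W(1) by (fastforce simp: A_def common_neighbors_def)
    show "finite {(a, c) \<in> A \<times> D. {a, c} \<in> E}"
      using finA finD by (auto intro: finite_subset[of _ "A \<times> D"])
  qed
  also have "\<dots> \<le> ?e (A \<union> D) + ?e (A \<inter> D)" by (rule card_pairs_le[OF E2])
  finally have "b * (real (card C) + real (card D)) < real (?e (A \<union> D)) + real (?e (A \<inter> D))"
    using dense by linarith
  \<comment> \<open>Cardinality is modular, so the vertex counts of union and intersection add up to
    \<open>card C + card D\<close>; hence one of the two sets exceeds density
    \<open>b\<close>.\<close>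
  moreover have "card (A \<union> D) + card (A \<inter> D) = card C + card D"
    using card_Un_Int[OF finA finD] cardA by simp
  then have "real (card C) + real (card D) = real (card (A \<union> D)) + real (card (A \<inter> D))"
    by linarith
  ultimately have "b * real (card (A \<union> D)) + b * real (card (A \<inter> D)) <
      real (?e (A \<union> D)) + real (?e (A \<inter> D))" by (simp add: distrib_left)
  then have "b * real (card (A \<union> D)) < real (?e (A \<union> D)) \<or>
      b * real (card (A \<inter> D)) < real (?e (A \<inter> D))" by linarith
  then obtain U where U: "U = A \<union> D \<or> U = A \<inter> D" "b * real (card U) < real (?e U)" by blast
  have "U \<noteq> {}"
  proof
    assume "U = {}"
    then have no_edges: "{e \<in> E. e \<subseteq> U} = {}" using E2(2) by fastforce
    show False using U(2) unfolding no_edges using \<open>U = {}\<close> by simp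
  qed
  moreover have "U \<subseteq> {1..n}" using U(1) A D' by auto
  \<comment> \<open>This bound is free of \<open>n\<close>, as the first moment method
    requires.\<close>
  moreover have "card U \<le> card (vertices X) + card ?F * m"
  proof -
    have "card U \<le> card (A \<union> D)" using U(1) finA finD by (auto intro: card_mono)
    also have "\<dots> \<le> card C + card D" using card_Un_le[of A D] cardA by simp
    also have "card C \<le> card (vertices X)" by (rule card_mono[OF fin_vert C'])
    also have "card D \<le> card (Fset_total ?F W)"
      by (rule card_mono[OF Fset_total_finite[OF F(1) W(3)] D])
    also have "\<dots> \<le> card ?F * m"
      using card_UN_le[OF F(1), of W] W(2) by (simp add: Fset_total_def)
    finally show ?thesis by simp
  qed
  ultimately show ?thesis using U(2) by blast
qed

section \<open>Above the threshold\<close>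

text \<open>The tags \<open>Inl\<close> and \<open>Inr\<close> keep the vertices of \<open>X\<close>
  apart from the prospective common neighbors. Each face lies in a facet \<open>g\<close>, and the
  \<open>m\<close> images of \<open>W g\<close> are adjacent to the whole image of \<open>g\<close>,
  hence to that of the face.\<close>

lemma embedding_imp_copy:
  fixes X :: "'a set set" and W :: "'a set \<Rightarrow> 'w set"
  assumes "finite X" and W: "\<forall>f\<in>facets X. card (W f) = m"
    and inj: "inj_on \<psi> (Inl ` vertices X \<union> Inr ` Fset_total (facets X) W)"
    and ran: "\<psi> ` (Inl ` vertices X \<union> Inr ` Fset_total (facets X) W) \<subseteq> N"
    and edges: "\<forall>f\<in>facets X. \<forall>a\<in>f. \<forall>c\<in>W f. {\<psi> (Inl a), \<psi> (Inr c)} \<in> E"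
    and "finite N"
  shows "contains_copy (neighborhood_complex m N E) X"
proof -
  let ?V = "Inl ` vertices X \<union> Inr ` Fset_total (facets X) W"
  define \<phi> where "\<phi> a = \<psi> (Inl a)" for a
  have face: "\<phi> ` f \<in> neighborhood_complex m N E" if f: "f \<in> X" for f
  proof -
    obtain g where g: "g \<in> facets X" "f \<subseteq> g" using ex_facet_superset[OF assms(1) f] by metis
    have sub: "Inl ` f \<subseteq> ?V" "Inr ` W g \<subseteq> ?V"
      using f g(1) by (auto simp: vertices_def Fset_total_def)
    have "m = card (\<psi> ` Inr ` W g)"
      using W g(1) inj_on_subset[OF inj sub(2)] by (simp add: card_image)
    also have "\<dots> \<le> card (common_neighbors N E (\<phi> ` f))"
    proof (rule card_mono)
      show "finite (common_neighbors N E (\<phi> ` f))"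
        using \<open>finite N\<close> by (simp add: common_neighbors_def)
      show "\<psi> ` Inr ` W g \<subseteq> common_neighbors N E (\<phi> ` f)"
      proof
        fix v assume "v \<in> \<psi> ` Inr ` W g"
        then obtain c where c: "c \<in> W g" "v = \<psi> (Inr c)" by auto
        have "v \<in> N" using c sub(2) ran by blast
        \<comment> \<open>Common neighbors must lie outside the face; injectivity of
          \<open>\<psi>\<close> on the tagged sum provides this.\<close>
        moreover have "v \<notin> \<phi> ` f"
        proof
          assume "v \<in> \<phi> ` f"
          then obtain a where "a \<in> f" "\<psi> (Inl a) = \<psi> (Inr c)" using c(2) by (auto simp: \<phi>_def)
          moreover from this have "Inl a \<in> ?V" "Inr c \<in> ?V" using sub c(1) by blast+
          ultimately show False using inj_onD[OF inj] by blast
        qed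
        moreover have "{u, v} \<in> E" if "u \<in> \<phi> ` f" for u
          using that edges g c by (auto simp: \<phi>_def)
        ultimately show "v \<in> common_neighbors N E (\<phi> ` f)" by (simp add: common_neighbors_def)
      qed
    qed
    finally have "m \<le> card (common_neighbors N E (\<phi> ` f))" .
    moreover have "\<phi> ` f \<subseteq> N" using sub(1) ran unfolding \<phi>_def by blast
    ultimately show ?thesis by (simp add: neighborhood_complex_def)
  qed
  have "inj_on \<phi> (vertices X)"
    using inj by (auto simp: inj_on_def \<phi>_def)
  moreover have "\<phi> ` vertices X \<subseteq> vertices (neighborhood_complex m N E)"
    using face by (auto simp: vertices_def)
  ultimately show ?thesis unfolding contains_copy_def using face by blast
qed

lemma prob_Gamma_complex:
  "measure_pmf.prob (Gamma_complex n m p) {K. contains_copy K X} =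
    measure_pmf.prob (erdos_renyi n p) {E. contains_copy (neighborhood_complex m {1..n} E) X}"
  by (simp add: Gamma_complex_def vimage_def)

lemma appears_above_m_density:
  fixes X :: "'a set set"
  assumes X: "abstract_simplicial_complex X" "finite X" and "b > 0"
    and b: "m_density (facets X) m (complex_shape X) < b"
  shows "(\<lambda>n. measure_pmf.prob (Gamma_complex n m (real n powr (- 1 / b)))
    {K. contains_copy K X}) \<longlonglongrightarrow> 1"
proof -
  let ?F = "facets X"
  have F: "finite ?F" "\<forall>f\<in>?F. finite f"
    using X by (auto simp: facets_def abstract_simplicial_complex_def)
  have fin_vert: "finite (vertices X)"
    using X by (auto simp: vertices_def abstract_simplicial_complex_def)
  obtain w where w: "is_shape ?F w" "is_pure ?F m w" "max_density ?F (complex_shape X) w < b"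
    using m_density_attained[OF F(1)] b by metis
  obtain W :: "'a set \<Rightarrow> nat set" where W: "\<forall>f\<in>?F. finite (W f)" "w = shape_of ?F W"
    using is_shape_obtain[OF w(1)] by metis
  have cardW: "\<forall>f\<in>?F. card (W f) = m"
    using w(2) W(2) by (auto simp: is_pure_def Fset_inter_def)
  define R where "R = (\<Union>f\<in>?F. f \<times> W f)"
  \<comment> \<open>The pairs in \<open>R\<close> become edges on the disjoint sum; the tags make
    \<open>h\<close> injective, so edges can be counted in \<open>R\<close>.\<close>
  define h :: "'a \<times> nat \<Rightarrow> ('a + nat) set" where "h = (\<lambda>(a, c). {Inl a, Inr c})"
  define V where "V = (Inl ` vertices X \<union> Inr ` Fset_total ?F W :: ('a + nat) set)"
  let ?pr = "\<lambda>n. measure_pmf.prob (erdos_renyi n (real n powr (- 1 / b)))"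
  let ?G = "\<lambda>n. {E. \<exists>\<psi>. inj_on \<psi> V \<and> \<psi> ` V \<subseteq> {1..n} \<and> (`) \<psi> ` h ` R \<subseteq> E}"
  have inj_h: "inj h" by (auto simp: inj_def h_def doubleton_eq_iff)
  have lim: "(\<lambda>n. ?pr n (?G n)) \<longlonglongrightarrow> 1"
  proof (rule graph_appears_above_threshold[OF _ _ \<open>b > 0\<close>])
    show "finite V" using fin_vert Fset_total_finite[OF F(1) W(1)] by (simp add: V_def)
    show "e \<subseteq> V \<and> card e = 2" if "e \<in> h ` R" for e
      using that by (auto simp: R_def h_def V_def vertices_def Fset_total_def facets_def)
    fix S assume S: "S \<subseteq> V" "S \<noteq> {}"
    \<comment> \<open>The two sides of \<open>S\<close>: the edges inside \<open>S\<close>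
      correspond to \<open>R \<inter> C \<times> D\<close>, to which the density bound
      applies.\<close>
    define C where "C = Inl -` S"
    define D where "D = Inr -` S"
    have S_eq: "S = Inl ` C \<union> Inr ` D"
    proof (intro equalityI subsetI)
      fix s assume "s \<in> S"
      then show "s \<in> Inl ` C \<union> Inr ` D" by (cases s) (auto simp: C_def D_def)
    qed (auto simp: C_def D_def)
    have C: "C \<subseteq> Fset_total ?F (\<lambda>f. f)"
      using S(1) by (auto simp: C_def V_def Fset_total_facets[OF X(2)])
    have D: "D \<subseteq> Fset_total ?F W" using S(1) by (auto simp: D_def V_def)
    have "finite C" "finite D"
      using finite_subset[OF C Fset_total_finite[OF F]]
        finite_subset[OF D Fset_total_finite[OF F(1) W(1)]] by auto
    then have cardS: "card S = card C + card D"
      unfolding S_eq by (subst card_Un_disjoint) (auto simp: card_image)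
    have "{e \<in> h ` R. e \<subseteq> S} = h ` (R \<inter> C \<times> D)" by (auto simp: h_def C_def D_def)
    then have "card {e \<in> h ` R. e \<subseteq> S} = card (R \<inter> C \<times> D)"
      using card_image[OF inj_on_subset[OF inj_h]] by simp
    moreover have "C \<noteq> {} \<or> D \<noteq> {}" using S(2) S_eq by auto
    then have "real (card (R \<inter> C \<times> D)) < b * (real (card C) + real (card D))"
      unfolding R_def
      using max_density_lessD[OF F W(1) \<open>b > 0\<close> _ C D] w(3) by (simp add: complex_shape_def W(2))
    ultimately show "real (card {e \<in> h ` R. e \<subseteq> S}) < b * real (card S)"
      by (simp add: cardS)
  qed
  have le: "?pr n (?G n) \<le> ?pr n {E. contains_copy (neighborhood_complex m {1..n} E) X}" for n
  proof (intro measure_pmf.finite_measure_mono subsetI)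
    fix E assume "E \<in> ?G n"
    then obtain \<psi> where \<psi>: "inj_on \<psi> V" "\<psi> ` V \<subseteq> {1..n}" "(`) \<psi> ` h ` R \<subseteq> E" by auto
    have "\<forall>f\<in>?F. \<forall>a\<in>f. \<forall>c\<in>W f. {\<psi> (Inl a), \<psi> (Inr c)} \<in> E"
    proof (intro ballI)
      fix f a c assume "f \<in> ?F" "a \<in> f" "c \<in> W f"
      then have "\<psi> ` h (a, c) \<in> E" using \<psi>(3) unfolding R_def by blast
      then show "{\<psi> (Inl a), \<psi> (Inr c)} \<in> E" by (simp add: h_def)
    qed
    then show "E \<in> {E. contains_copy (neighborhood_complex m {1..n} E) X}"
      using embedding_imp_copy[OF X(2) cardW, of \<psi> "{1..n}" E] \<psi>(1,2) by (simp add: V_def)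
  qed auto
  show ?thesis
    unfolding prob_Gamma_complex
  proof (rule tendsto_sandwich[OF _ _ lim tendsto_const])
    show "eventually (\<lambda>n. ?pr n (?G n) \<le>
        ?pr n {E. contains_copy (neighborhood_complex m {1..n} E) X}) sequentially"
      using le by (rule always_eventually[OF allI])
    show "eventually (\<lambda>n. ?pr n {E. contains_copy (neighborhood_complex m {1..n} E) X} \<le> 1)
        sequentially" by simp
  qed
qed

lemma not_appears_below_m_density:
  fixes X :: "'a set set"
  assumes X: "abstract_simplicial_complex X" "finite X" and "b > 0"
    and b: "b < m_density (facets X) m (complex_shape X)"
  shows "(\<lambda>n. measure_pmf.prob (Gamma_complex n m (real n powr (- 1 / b)))
    {K. contains_copy K X}) \<longlonglongrightarrow> 0"
proof -
  let ?M = "\<lambda>n. erdos_renyi n (real n powr (- 1 / b))"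
  let ?A = "\<lambda>n. {E. contains_copy (neighborhood_complex m {1..n} E) X}"
  let ?B = "\<lambda>n. {E. E \<subseteq> possible_edges n \<and> (\<exists>U\<subseteq>{1..n}. U \<noteq> {} \<and>
      card U \<le> card (vertices X) + card (facets X) * m \<and>
      b * real (card U) < real (card {e \<in> E. e \<subseteq> U}))}"
  have "measure_pmf.prob (?M n) (?A n) \<le> measure_pmf.prob (?M n) (?B n)" for n
  proof -
    \<comment> \<open>Sets outside the support need not consist of possible edges, but they carry no
      probability.\<close>
    have "?A n \<inter> set_pmf (?M n) \<subseteq> ?B n"
    proof
      fix E assume E: "E \<in> ?A n \<inter> set_pmf (?M n)"
      then have "E \<subseteq> possible_edges n" by (blast dest: set_pmf_erdos_renyi)
      then show "E \<in> ?B n" using copy_imp_dense_subset[OF X \<open>b > 0\<close> b] E by auto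
    qed
    then have "measure_pmf.prob (?M n) (?A n \<inter> set_pmf (?M n)) \<le> measure_pmf.prob (?M n) (?B n)"
      by (intro measure_pmf.finite_measure_mono) auto
    then show ?thesis by (simp add: measure_Int_set_pmf)
  qed
  then have le: "eventually (\<lambda>n. measure_pmf.prob (?M n) (?A n) \<le> measure_pmf.prob (?M n) (?B n))
      sequentially" by (rule always_eventually[OF allI])
  show ?thesis
    unfolding prob_Gamma_complex
    by (rule tendsto_sandwich[OF _ le tendsto_const dense_subset_below_threshold[OF \<open>b > 0\<close>]]) simp
qed

theorem theorem2:
  fixes X :: "'a set set" and m :: nat and b :: real
  assumes "abstract_simplicial_complex X" and "finite X"
    and "m \<ge> 1"
    and "b > 0"
  shows "(b > m_density (facets X) m (complex_shape X) \<longrightarrow>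
            (\<lambda>n. measure_pmf.prob (Gamma_complex n m (real n powr (- 1 / b)))
                   {K. contains_copy K X}) \<longlonglongrightarrow> 1) \<and>
         (b < m_density (facets X) m (complex_shape X) \<longrightarrow>
            (\<lambda>n. measure_pmf.prob (Gamma_complex n m (real n powr (- 1 / b)))
                   {K. contains_copy K X}) \<longlonglongrightarrow> 0)"
  using appears_above_m_density[OF assms(1,2,4)] not_appears_below_m_density[OF assms(1,2,4)]
  by blast

end
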